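(* Let $(A,\Delta)$ be an algebraic quantum group with dual $B=\widehat A$, and let $V\in M(B\otimes A)$ be the unique element with $\langle V,a\otimes b\rangle=\langle a,b\rangle$ for all $a\in A$, $b\in B$. Let $B\otimes A$ act on $A\otimes A$ from the left by $(b\otimes a)\triangleright(x\otimes x')=(b\triangleright x)\otimes ax'$, and extend this unital action to $M(B\otimes A)$. Then $V$ acts on $A\otimes A$ as the canonical map $T:A\otimes A\to A\otimes A$ defined by $T(x\otimes x')=\Delta(x)(1\otimes x')$.
   Context: All algebras are associative algebras over $\mathbb C$, possibly non-unital, with non-degenerate product; $M(A)$ is the multiplier algebra of $A$; $\iota$ denotes identity maps. Regular multiplier Hopf algebra: an algebra $A$ with a homomorphism $\Delta:A\to M(A\otimes A)$ such that $\Delta(a)(1\otimes a')$, $(a\otimes 1)\Delta(a')$, $\Delta(a)(a'\otimes 1)$ and $(1\otimes a)\Delta(a')$ lie in $A\otimes A$ for all $a,a'$; $\Delta$ is coassociative, $(a\otimes1\otimes1)(\Delta\otimes\iota)(\Delta(c)(1\otimes a'))=((\iota\otimes\Delta)((a\otimes1)\Delta(c)))(1\otimes1\otimes a')$; and the maps $a\otimes a'\mapsto\Delta(a)(1\otimes a')$, $a\otimes a'\mapsto(a\otimes1)\Delta(a')$, and the same two maps for the flipped coproduct, are bijections of $A\otimes A$. It has a unique counit $\varepsilon$ and a bijective antipode $S$. A left integral is a non-zero linear functional $\varphi$ on $A$ with $(\iota\otimes\varphi)\Delta(a)=\varphi(a)1$ in $M(A)$ for all $a$. An algebraic quantum group is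 a regular multiplier Hopf algebra with (left and right) integrals. Fix a left integral $\varphi$. Dual: $B=\widehat A=\{\varphi(\,\cdot\,c):c\in A\}$, with $\langle a,b\rangle=b(a)$. Its product is $\langle a,bb'\rangle=\langle\Delta(a),b\otimes b'\rangle$; with a suitable coproduct $B$ is again an algebraic quantum group. There are unital left actions given by $\langle a',a\triangleright b\rangle=\langle a'a,b\rangle$ and $\langle b\triangleright a,b'\rangle=\langle a,b'b\rangle$; thus $b\triangleright x=(\iota\otimes\langle\,\cdot\,,b\rangle)\Delta(x)$. The pairing of $B\otimes A$ with $A\otimes B$ is $\langle b\otimes a,a'\otimes b'\rangle=\langle a',b\rangle\langle a,b'\rangle$; it extends uniquely to $M(B\otimes A)\times(A\otimes B)$ by $\langle m,(b\triangleright a')\otimes(a\triangleright b')\rangle=\langle m(b\otimes a),a'\otimes b'\rangle$. This is the pairing in the definition of $V$; existence and uniqueness of $V$ are known. A unital action is one for which the space is spanned by the elements $c\triangleright\xi$. A unital (and non-degenerate) left action of an algebra $C$ on a space $X$ extends uniquely to $M(C)$ by $m\triangleright(c\triangleright\xi)=(mc)\triangleright\xi$ for $m\in M(C)$, $c\in C$, $\xi\in X$. *)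

theory Defs
  imports Complex_Main "HOL-Library.Poly_Mapping"
begin

section \<open>Complex vector spaces and algebras\<close>

class complex_vector = ab_group_add +
  fixes scaleC :: "complex \<Rightarrow> 'a \<Rightarrow> 'a" (infixr "*\<^sub>C" 75)
  assumes scaleC_add_right: "c *\<^sub>C (x + y) = c *\<^sub>C x + c *\<^sub>C y"
    and scaleC_add_left: "(c + d) *\<^sub>C x = c *\<^sub>C x + d *\<^sub>C x"
    and scaleC_scaleC: "c *\<^sub>C d *\<^sub>C x = (c * d) *\<^sub>C x"
    and scaleC_one: "1 *\<^sub>C x = x"

global_interpretation cvs: vector_space "scaleC :: complex \<Rightarrow> 'a \<Rightarrow> 'a::complex_vector"
  by unfold_locales (simp_all add: scaleC_add_right scaleC_add_left scaleC_scaleC scaleC_one)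

abbreviation clinear :: "('a::complex_vector \<Rightarrow> 'b::complex_vector) \<Rightarrow> bool" where
  "clinear \<equiv> Vector_Spaces.linear scaleC scaleC"

definition cbilinear :: "('a::complex_vector \<Rightarrow> 'b::complex_vector \<Rightarrow> 'c::complex_vector) \<Rightarrow> bool" where
  "cbilinear f \<longleftrightarrow> (\<forall>y. clinear (\<lambda>x. f x y)) \<and> (\<forall>x. clinear (f x))"

lemma clinearI:
  assumes "\<And>x y. f (x + y) = f x + f y" and "\<And>c x. f (c *\<^sub>C x) = c *\<^sub>C f x"
  shows "clinear f"
  using assms by unfold_locales

lemma clinear_add: "clinear f \<Longrightarrow> f (x + y) = f x + f y"
  by (simp add: Vector_Spaces.linear_iff)

lemma clinear_scale: "clinear f \<Longrightarrow> f (c *\<^sub>C x) = c *\<^sub>C f x"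
  by (simp add: Vector_Spaces.linear_iff)

lemma clinear_0: "clinear f \<Longrightarrow> f 0 = 0"
  using clinear_scale[of f 0 0] by simp

lemma clinear_diff: "clinear f \<Longrightarrow> f (x - y) = f x - f y"
  using clinear_add[of f "x - y" y] by (simp add: algebra_simps)

lemma clinear_compose: "clinear f \<Longrightarrow> clinear g \<Longrightarrow> clinear (\<lambda>x. g (f x))"
  by (rule clinearI) (simp_all add: clinear_add clinear_scale)

lemma clinear_id: "clinear (\<lambda>x. x)"
  by (rule clinearI) simp_all

lemma clinear_plus: "clinear f \<Longrightarrow> clinear g \<Longrightarrow> clinear (\<lambda>x. f x + g x)"
  by (rule clinearI) (simp_all add: clinear_add clinear_scale scaleC_add_right)

lemma clinear_smult: "clinear f \<Longrightarrow> clinear (\<lambda>x. d *\<^sub>C f x)"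
  by (rule clinearI) (simp_all add: clinear_add clinear_scale scaleC_add_right scaleC_scaleC mult.commute)

lemma cbilinearI:
  assumes "\<And>x x' y. f (x + x') y = f x y + f x' y" and "\<And>c x y. f (c *\<^sub>C x) y = c *\<^sub>C f x y"
    and "\<And>x y y'. f x (y + y') = f x y + f x y'" and "\<And>c x y. f x (c *\<^sub>C y) = c *\<^sub>C f x y"
  shows "cbilinear f"
  unfolding cbilinear_def by (auto intro!: clinearI simp: assms)

lemma cbilinear_add_left: "cbilinear f \<Longrightarrow> f (x + x') y = f x y + f x' y"
  and cbilinear_add_right: "cbilinear f \<Longrightarrow> f x (y + y') = f x y + f x y'"
  and cbilinear_scale_left: "cbilinear f \<Longrightarrow> f (c *\<^sub>C x) y = c *\<^sub>C f x y"
  and cbilinear_scale_right: "cbilinear f \<Longrightarrow> f x (c *\<^sub>C y) = c *\<^sub>C f x y"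
  unfolding cbilinear_def
  by (auto dest: spec simp: clinear_add[of "f x"] clinear_scale[of "f x"]
      clinear_add[of "\<lambda>x. f x y"] clinear_scale[of "\<lambda>x. f x y"])

lemmas cbilinear_simps = cbilinear_add_left cbilinear_add_right
  cbilinear_scale_left cbilinear_scale_right

instantiation complex :: complex_vector
begin
definition scaleC_complex :: "complex \<Rightarrow> complex \<Rightarrow> complex" where "scaleC_complex = (*)"
instance by standard (simp_all add: scaleC_complex_def algebra_simps)
end

text \<open>Algebras are associative and possibly non-unital (type class \<^class>\<open>ring\<close>).\<close>

class complex_algebra = complex_vector + ring +
  assumes mult_scaleC_left: "(c *\<^sub>C x) * y = c *\<^sub>C (x * y)"
    and mult_scaleC_right: "x * (c *\<^sub>C y) = c *\<^sub>C (x * y)"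

class nondegenerate_algebra = complex_algebra +
  assumes nondegenerate_left: "(\<And>y. x * y = 0) \<Longrightarrow> x = 0"
    and nondegenerate_right: "(\<And>y. y * x = 0) \<Longrightarrow> x = 0"

lemma cbilinear_mult: "cbilinear ((*) :: 'a::complex_algebra \<Rightarrow> 'a \<Rightarrow> 'a)"
  by (rule cbilinearI) (simp_all add: distrib_left distrib_right mult_scaleC_left mult_scaleC_right)

lemma clinear_mult_left: "clinear ((*) (x :: 'a::complex_algebra))"
  and clinear_mult_right: "clinear (\<lambda>y. y * (x :: 'a::complex_algebra))"
  using cbilinear_mult unfolding cbilinear_def by auto


section \<open>The algebraic tensor product\<close>

text \<open>The quotient of the free vector space on \<open>'a \<times> 'b\<close> by the bilinearity relations.\<close>

inductive tensor_null :: "('a::complex_vector \<times> 'b::complex_vector \<Rightarrow>\<^sub>0 complex) \<Rightarrow> bool" where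
  zero: "tensor_null 0"
| add: "tensor_null r \<Longrightarrow> tensor_null s \<Longrightarrow> tensor_null (r + s)"
| scale: "tensor_null r \<Longrightarrow> tensor_null (Poly_Mapping.map ((*) c) r)"
| add_left: "tensor_null (Poly_Mapping.single (x + x', y) 1
    - Poly_Mapping.single (x, y) 1 - Poly_Mapping.single (x', y) 1)"
| add_right: "tensor_null (Poly_Mapping.single (x, y + y') 1
    - Poly_Mapping.single (x, y) 1 - Poly_Mapping.single (x, y') 1)"
| scale_left: "tensor_null (Poly_Mapping.single (c *\<^sub>C x, y) 1 - Poly_Mapping.single (x, y) c)"
| scale_right: "tensor_null (Poly_Mapping.single (x, c *\<^sub>C y) 1 - Poly_Mapping.single (x, y) c)"

definition tensor_rel ::
  "('a::complex_vector \<times> 'b::complex_vector \<Rightarrow>\<^sub>0 complex) \<Rightarrow> ('a \<times> 'b \<Rightarrow>\<^sub>0 complex) \<Rightarrow> bool" where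
  "tensor_rel r s \<longleftrightarrow> tensor_null (r - s)"

lemma lookup_scale: "Poly_Mapping.lookup (Poly_Mapping.map ((*) (c::complex)) r) k = c * Poly_Mapping.lookup r k"
  by (simp add: Poly_Mapping.map.rep_eq when_def)

lemma map_minus_one: "Poly_Mapping.map ((*) (-1 :: complex)) r = - r"
  by (rule poly_mapping_eqI) (simp add: lookup_scale)

lemma tensor_null_uminus: "tensor_null r \<Longrightarrow> tensor_null (- r)"
  using tensor_null.scale[of r "-1"] by (simp only: map_minus_one)

lemma equivp_tensor_rel:
  "equivp (tensor_rel :: ('a::complex_vector \<times> 'b::complex_vector \<Rightarrow>\<^sub>0 complex) \<Rightarrow> _)"
proof (rule equivpI)
  show "reflp tensor_rel" by (rule reflpI) (simp add: tensor_rel_def tensor_null.zero)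
  show "symp tensor_rel"
    by (rule sympI) (metis tensor_rel_def tensor_null_uminus minus_diff_eq)
  show "transp (tensor_rel :: ('a \<times> 'b \<Rightarrow>\<^sub>0 complex) \<Rightarrow> _)"
  proof (rule transpI)
    fix r s t :: "'a \<times> 'b \<Rightarrow>\<^sub>0 complex"
    assume "tensor_rel r s" "tensor_rel s t"
    then have "tensor_null ((r - s) + (s - t))" unfolding tensor_rel_def by (rule tensor_null.add)
    then show "tensor_rel r t" by (simp add: tensor_rel_def)
  qed
qed

quotient_type (overloaded) ('a, 'b) tensor =
  "'a::complex_vector \<times> 'b::complex_vector \<Rightarrow>\<^sub>0 complex" / tensor_rel
  by (rule equivp_tensor_rel)

instantiation tensor :: (complex_vector, complex_vector) complex_vector
begin

lift_definition zero_tensor :: "('a, 'b) tensor" is 0 .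

lift_definition plus_tensor :: "('a, 'b) tensor \<Rightarrow> ('a, 'b) tensor \<Rightarrow> ('a, 'b) tensor" is "(+)"
proof -
  fix p q r s :: "'a \<times> 'b \<Rightarrow>\<^sub>0 complex"
  assume "tensor_rel p q" "tensor_rel r s"
  then have "tensor_null ((p - q) + (r - s))" unfolding tensor_rel_def by (rule tensor_null.add)
  then show "tensor_rel (p + r) (q + s)" by (simp add: tensor_rel_def algebra_simps)
qed

lift_definition uminus_tensor :: "('a, 'b) tensor \<Rightarrow> ('a, 'b) tensor" is "uminus"
proof -
  fix p q :: "'a \<times> 'b \<Rightarrow>\<^sub>0 complex"
  assume "tensor_rel p q"
  then have "tensor_null (- (p - q))" unfolding tensor_rel_def by (rule tensor_null_uminus)
  then show "tensor_rel (- p) (- q)" by (simp add: tensor_rel_def)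
qed

definition minus_tensor :: "('a, 'b) tensor \<Rightarrow> ('a, 'b) tensor \<Rightarrow> ('a, 'b) tensor" where
  "minus_tensor x y = x + (- y)"

lift_definition scaleC_tensor :: "complex \<Rightarrow> ('a, 'b) tensor \<Rightarrow> ('a, 'b) tensor"
  is "\<lambda>c. Poly_Mapping.map ((*) c)"
proof -
  fix c and p q :: "'a \<times> 'b \<Rightarrow>\<^sub>0 complex"
  assume "tensor_rel p q"
  then have "tensor_null (Poly_Mapping.map ((*) c) (p - q))"
    unfolding tensor_rel_def by (rule tensor_null.scale)
  moreover have "Poly_Mapping.map ((*) c) (p - q) = Poly_Mapping.map ((*) c) p - Poly_Mapping.map ((*) c) q"
    by (rule poly_mapping_eqI) (simp add: lookup_scale lookup_minus algebra_simps)
  ultimately show "tensor_rel (Poly_Mapping.map ((*) c) p) (Poly_Mapping.map ((*) c) q)"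
    by (simp add: tensor_rel_def)
qed

instance
proof
  fix a b c :: "('a, 'b) tensor" and x y :: complex
  show "a + b + c = a + (b + c)"
    by transfer (simp add: add.assoc equivp_reflp[OF equivp_tensor_rel])
  show "a + b = b + a"
    by transfer (simp add: add.commute equivp_reflp[OF equivp_tensor_rel])
  show "0 + a = a" by transfer (simp add: equivp_reflp[OF equivp_tensor_rel])
  show "- a + a = 0" by transfer (simp add: equivp_reflp[OF equivp_tensor_rel])
  show "a - b = a + - b" by (rule minus_tensor_def)
  have eq: "tensor_rel p q" if "p = q" for p q :: "'a \<times> 'b \<Rightarrow>\<^sub>0 complex"
    using that by (simp add: equivp_reflp[OF equivp_tensor_rel])
  show "x *\<^sub>C (a + b) = x *\<^sub>C a + x *\<^sub>C b"
    by transfer (rule eq, rule poly_mapping_eqI, simp add: lookup_scale lookup_add algebra_simps)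
  show "(x + y) *\<^sub>C a = x *\<^sub>C a + y *\<^sub>C a"
    by transfer (rule eq, rule poly_mapping_eqI, simp add: lookup_scale lookup_add algebra_simps)
  show "x *\<^sub>C y *\<^sub>C a = (x * y) *\<^sub>C a"
    by transfer (rule eq, rule poly_mapping_eqI, simp add: lookup_scale algebra_simps)
  show "1 *\<^sub>C a = a"
    by transfer (rule eq, rule poly_mapping_eqI, simp add: lookup_scale)
qed

end

lift_definition tens :: "'a::complex_vector \<Rightarrow> 'b::complex_vector \<Rightarrow> ('a, 'b) tensor" (infixl "\<otimes>" 73)
  is "\<lambda>x y. Poly_Mapping.single (x, y) 1" .

lemma tensor_rel_by_diff: "tensor_null (p - q) \<Longrightarrow> tensor_rel p q"
  by (simp add: tensor_rel_def)

lemma cbilinear_tens: "cbilinear (\<otimes>)"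
proof (rule cbilinearI)
  fix x x' :: 'a and y y' :: 'b and c :: complex
  show "(x + x') \<otimes> y = x \<otimes> y + x' \<otimes> y"
    by transfer (rule tensor_rel_by_diff, metis tensor_null.add_left diff_diff_add)
  show "x \<otimes> (y + y') = x \<otimes> y + x \<otimes> y'"
    by transfer (rule tensor_rel_by_diff, metis tensor_null.add_right diff_diff_add)
  have m: "Poly_Mapping.map ((*) c) (Poly_Mapping.single k 1) = Poly_Mapping.single k c" for k :: "'a \<times> 'b" and c :: complex
    by (rule poly_mapping_eqI) (simp add: lookup_scale lookup_single when_def)
  show "(c *\<^sub>C x) \<otimes> y = c *\<^sub>C (x \<otimes> y)"
    by transfer (rule tensor_rel_by_diff, simp only: m tensor_null.scale_left)
  show "x \<otimes> (c *\<^sub>C y) = c *\<^sub>C (x \<otimes> y)"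
    by transfer (rule tensor_rel_by_diff, simp only: m tensor_null.scale_right)
qed

lemmas tens_simps = cbilinear_simps[OF cbilinear_tens]

lemma tens_0_left [simp]: "0 \<otimes> y = 0"
  using tens_simps(3)[of 0 0 y] by simp

lemma tens_0_right [simp]: "x \<otimes> 0 = 0"
  using tens_simps(4)[of x 0 0] by simp

lemma tensor_induct [case_names zero add, induct type: tensor]:
  assumes z: "P 0" and a: "\<And>t x y. P t \<Longrightarrow> P (t + x \<otimes> y)"
  shows "P t"
proof -
  have "P (abs_tensor r)" for r
  proof (induction r rule: update_induct)
    case const
    then show ?case using z by (simp add: zero_tensor.abs_eq[symmetric])
  next
    case (update r k c)
    obtain x y where k: "k = (x, y)" by (cases k)
    have "Poly_Mapping.update k c r = r + Poly_Mapping.map ((*) c) (Poly_Mapping.single k 1)"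
      using update by (intro poly_mapping_eqI)
        (auto simp: lookup_update lookup_add lookup_scale lookup_single when_def in_keys_iff)
    then have "abs_tensor (Poly_Mapping.update k c r) = abs_tensor r + (c *\<^sub>C x) \<otimes> y"
      unfolding k tens_simps by (simp add: plus_tensor.abs_eq scaleC_tensor.abs_eq tens.abs_eq)
    then show ?case using a update by simp
  qed
  then show ?thesis by (rule tensor.abs_induct)
qed

text \<open>The linear map on the tensor product that a bilinear map factors through.\<close>

definition tlift :: "('a::complex_vector \<Rightarrow> 'b::complex_vector \<Rightarrow> 'c::complex_vector)
    \<Rightarrow> ('a, 'b) tensor \<Rightarrow> 'c" where
  "tlift f = (THE h. clinear h \<and> (\<forall>x y. h (x \<otimes> y) = f x y))"

definition free_eval :: "('a::complex_vector \<Rightarrow> 'b::complex_vector \<Rightarrow> 'c::complex_vector)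
    \<Rightarrow> ('a \<times> 'b \<Rightarrow>\<^sub>0 complex) \<Rightarrow> 'c" where
  "free_eval f r = (\<Sum>k\<in>Poly_Mapping.keys r. Poly_Mapping.lookup r k *\<^sub>C f (fst k) (snd k))"

lemma free_eval_superset:
  assumes "finite K" "Poly_Mapping.keys r \<subseteq> K"
  shows "free_eval f r = (\<Sum>k\<in>K. Poly_Mapping.lookup r k *\<^sub>C f (fst k) (snd k))"
  unfolding free_eval_def using assms
  by (intro sum.mono_neutral_left) (auto simp: in_keys_iff)

lemma free_eval_add: "free_eval f (r + s) = free_eval f r + free_eval f s"
proof -
  let ?K = "Poly_Mapping.keys r \<union> Poly_Mapping.keys s"
  have "free_eval f (r + s) = (\<Sum>k\<in>?K. Poly_Mapping.lookup (r + s) k *\<^sub>C f (fst k) (snd k))"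
    by (rule free_eval_superset) (auto simp: Poly_Mapping.keys_add)
  also have "\<dots> = (\<Sum>k\<in>?K. Poly_Mapping.lookup r k *\<^sub>C f (fst k) (snd k))
      + (\<Sum>k\<in>?K. Poly_Mapping.lookup s k *\<^sub>C f (fst k) (snd k))"
    by (simp add: lookup_add scaleC_add_left sum.distrib)
  also have "\<dots> = free_eval f r + free_eval f s"
    by (intro arg_cong2[of _ _ _ _ "(+)"] free_eval_superset[symmetric]) auto
  finally show ?thesis .
qed

lemma free_eval_scale: "free_eval f (Poly_Mapping.map ((*) c) r) = c *\<^sub>C free_eval f r"
proof -
  have "free_eval f (Poly_Mapping.map ((*) c) r) =
      (\<Sum>k\<in>Poly_Mapping.keys r. Poly_Mapping.lookup (Poly_Mapping.map ((*) c) r) k *\<^sub>C f (fst k) (snd k))"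
    by (rule free_eval_superset) (auto simp: in_keys_iff lookup_scale)
  also have "\<dots> = c *\<^sub>C free_eval f r"
    by (simp add: free_eval_def lookup_scale scaleC_scaleC cvs.scale_sum_right)
  finally show ?thesis .
qed

lemma free_eval_uminus: "free_eval f (- r) = - free_eval f r"
  using free_eval_add[of f r "- r"] by (simp add: free_eval_def eq_neg_iff_add_eq_0 add.commute)

lemma free_eval_diff: "free_eval f (r - s) = free_eval f r - free_eval f s"
  using free_eval_add[of f r "- s"] by (simp add: free_eval_uminus)

lemma free_eval_single: "free_eval f (Poly_Mapping.single (x, y) c) = c *\<^sub>C f x y"
proof -
  have "free_eval f (Poly_Mapping.single (x, y) c) =
      (\<Sum>k\<in>{(x, y)}. Poly_Mapping.lookup (Poly_Mapping.single (x, y) c) k *\<^sub>C f (fst k) (snd k))"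
    by (rule free_eval_superset) auto
  then show ?thesis by simp
qed

lemma free_eval_null:
  assumes f: "cbilinear f"
  shows "tensor_null r \<Longrightarrow> free_eval f r = 0"
proof (induction rule: tensor_null.induct)
  case zero
  then show ?case by (simp add: free_eval_def)
next
  case (add r s)
  then show ?case by (simp add: free_eval_add)
next
  case (scale r c)
  then show ?case by (simp add: free_eval_scale)
next
  case (add_left x x' y)
  show ?case by (simp add: free_eval_diff free_eval_single cbilinear_add_left[OF f])
next
  case (add_right x y y')
  show ?case by (simp add: free_eval_diff free_eval_single cbilinear_add_right[OF f])
next
  case (scale_left c x y)
  show ?case by (simp add: free_eval_diff free_eval_single cbilinear_scale_left[OF f])
next
  case (scale_right x c y)
  show ?case by (simp add: free_eval_diff free_eval_single cbilinear_scale_right[OF f])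
qed

lemma tensor_universal:
  assumes f: "cbilinear f"
  shows "\<exists>!h. clinear h \<and> (\<forall>x y. h (x \<otimes> y) = f x y)"
proof (rule ex_ex1I)
  define h where "h t = free_eval f (rep_tensor t)" for t
  have h_abs: "h (abs_tensor r) = free_eval f r" for r
  proof -
    have "tensor_rel (rep_tensor (abs_tensor r)) r"
      by (simp add: Quotient_rep_abs[OF Quotient_tensor] equivp_reflp[OF equivp_tensor_rel])
    then have "free_eval f (rep_tensor (abs_tensor r) - r) = 0"
      unfolding tensor_rel_def by (rule free_eval_null[OF f])
    then show ?thesis by (simp add: h_def free_eval_diff)
  qed
  have "clinear h"
  proof (rule clinearI)
    fix s t :: "('a, 'b) tensor" and c
    obtain p q where "s = abs_tensor p" "t = abs_tensor q"
      by (metis Quotient_abs_rep[OF Quotient_tensor])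
    then show "h (s + t) = h s + h t" "h (c *\<^sub>C s) = c *\<^sub>C h s"
      by (simp_all add: plus_tensor.abs_eq scaleC_tensor.abs_eq h_abs free_eval_add free_eval_scale)
  qed
  moreover have "\<forall>x y. h (x \<otimes> y) = f x y"
    by (simp add: tens.abs_eq h_abs free_eval_single scaleC_one)
  ultimately show "\<exists>h. clinear h \<and> (\<forall>x y. h (x \<otimes> y) = f x y)" by blast
next
  fix g h' assume "clinear g \<and> (\<forall>x y. g (x \<otimes> y) = f x y)" 
    "clinear h' \<and> (\<forall>x y. h' (x \<otimes> y) = f x y)"
  then have "g t = h' t" for t
    by (induction t) (simp_all add: clinear_0 clinear_add)
  then show "g = h'" by blast
qed

lemma clinear_tlift: "cbilinear f \<Longrightarrow> clinear (tlift f)"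
  and tlift_tens: "cbilinear f \<Longrightarrow> tlift f (x \<otimes> y) = f x y"
  using theI'[OF tensor_universal[of f]] unfolding tlift_def by auto

lemma tlift_simps:
  assumes "cbilinear f"
  shows "tlift f 0 = 0" "tlift f (s + t) = tlift f s + tlift f t" "tlift f (c *\<^sub>C t) = c *\<^sub>C tlift f t"
  using clinear_tlift[OF assms] by (simp_all add: clinear_0 clinear_add clinear_scale)

lemma tensor_eqI:
  assumes "clinear f" "clinear g" "\<And>x y. f (x \<otimes> y) = g (x \<otimes> y)"
  shows "f t = g t"
  by (induction t) (simp_all add: assms clinear_0 clinear_add)

lemma clinear_tlift_param:
  assumes "\<And>u. cbilinear (f u)" "\<And>x y. clinear (\<lambda>u. f u x y)"
  shows "clinear (\<lambda>u. tlift (f u) t)"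
proof (induction t)
  case zero
  show ?case by (rule clinearI) (simp_all add: tlift_simps assms(1))
next
  case (add t x y)
  show ?case unfolding tlift_simps(2)[OF assms(1)] tlift_tens[OF assms(1)]
    by (intro clinear_plus add.IH assms(2))
qed

lemma cbilinear_compose:
  assumes "cbilinear f" "clinear g" "clinear h"
  shows "cbilinear (\<lambda>x y. f (g x) (h y))"
  by (rule cbilinearI) (simp_all add: cbilinear_simps[OF assms(1)] clinear_add[OF assms(2)]
      clinear_add[OF assms(3)] clinear_scale[OF assms(2)] clinear_scale[OF assms(3)])

lemma clinear_cbilinear:
  assumes "cbilinear f" "clinear g"
  shows "cbilinear (\<lambda>x y. g (f x y))"
  by (rule cbilinearI) (simp_all add: cbilinear_simps[OF assms(1)] clinear_add[OF assms(2)]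
      clinear_scale[OF assms(2)])

definition tmap :: "('a::complex_vector \<Rightarrow> 'c::complex_vector) \<Rightarrow> ('b::complex_vector \<Rightarrow> 'd::complex_vector)
    \<Rightarrow> ('a, 'b) tensor \<Rightarrow> ('c, 'd) tensor" where
  "tmap f g = tlift (\<lambda>x y. f x \<otimes> g y)"

definition tflip :: "('a::complex_vector, 'b::complex_vector) tensor \<Rightarrow> ('b, 'a) tensor" where
  "tflip = tlift (\<lambda>x y. y \<otimes> x)"

definition tassoc :: "(('a::complex_vector, 'b::complex_vector) tensor, 'c::complex_vector) tensor
    \<Rightarrow> ('a, ('b, 'c) tensor) tensor" where
  "tassoc = tlift (\<lambda>t z. tlift (\<lambda>x y. x \<otimes> (y \<otimes> z)) t)"

lemma cbilinear_tmap: "clinear f \<Longrightarrow> clinear g \<Longrightarrow> cbilinear (\<lambda>x y. f x \<otimes> g y)"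
  by (rule cbilinear_compose[OF cbilinear_tens])

lemma clinear_tmap: "clinear f \<Longrightarrow> clinear g \<Longrightarrow> clinear (tmap f g)"
  and tmap_tens: "clinear f \<Longrightarrow> clinear g \<Longrightarrow> tmap f g (x \<otimes> y) = f x \<otimes> g y"
  unfolding tmap_def by (simp_all add: clinear_tlift tlift_tens cbilinear_tmap)

lemma cbilinear_flip: "cbilinear (\<lambda>x y. y \<otimes> x)"
  by (rule cbilinearI) (simp_all add: tens_simps)

lemma clinear_tflip: "clinear tflip"
  and tflip_tens: "tflip (x \<otimes> y) = y \<otimes> x"
  unfolding tflip_def by (simp_all add: clinear_tlift tlift_tens cbilinear_flip)

lemma tflip_tflip: "tflip (tflip t) = t"
  by (induction t) (simp_all add: clinear_0 clinear_add clinear_tflip tflip_tens)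

lemma cbilinear_assoc_inner: "cbilinear (\<lambda>x y. x \<otimes> (y \<otimes> z))"
  by (rule cbilinearI) (simp_all add: tens_simps)

lemma cbilinear_assoc: "cbilinear (\<lambda>t z. tlift (\<lambda>x y. x \<otimes> (y \<otimes> z)) t)"
  unfolding cbilinear_def
proof (intro conjI allI)
  fix z :: 'c
  show "clinear (\<lambda>t :: ('a, 'b) tensor. tlift (\<lambda>x y. x \<otimes> (y \<otimes> z)) t)"
    using clinear_tlift[OF cbilinear_assoc_inner] .
next
  fix t :: "('a, 'b) tensor"
  show "clinear (\<lambda>z :: 'c. tlift (\<lambda>x y. x \<otimes> (y \<otimes> z)) t)"
    by (rule clinear_tlift_param[OF cbilinear_assoc_inner]) (rule clinearI, simp_all add: tens_simps)
qed

lemma clinear_tassoc: "clinear tassoc"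
  and tassoc_tens: "tassoc ((x \<otimes> y) \<otimes> z) = x \<otimes> (y \<otimes> z)"
  unfolding tassoc_def
  by (simp_all add: clinear_tlift[OF cbilinear_assoc] tlift_tens[OF cbilinear_assoc]
      tlift_tens[OF cbilinear_assoc_inner])

text \<open>The slice maps \<open>\<iota> \<otimes> \<omega>\<close> and \<open>\<omega> \<otimes> \<iota>\<close>.\<close>

definition slice_right :: "('b::complex_vector \<Rightarrow> complex) \<Rightarrow> ('a::complex_vector, 'b) tensor \<Rightarrow> 'a" where
  "slice_right w = tlift (\<lambda>x y. w y *\<^sub>C x)"

definition slice_left :: "('a::complex_vector \<Rightarrow> complex) \<Rightarrow> ('a, 'b::complex_vector) tensor \<Rightarrow> 'b" where
  "slice_left w = tlift (\<lambda>x y. w x *\<^sub>C y)"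

lemma cbilinear_slices:
  assumes "clinear w"
  shows "cbilinear (\<lambda>x y. w y *\<^sub>C x)" "cbilinear (\<lambda>x y. w x *\<^sub>C y)"
  by (rule cbilinearI; simp add: clinear_add[OF assms] clinear_scale[OF assms] scaleC_add_right
      scaleC_add_left scaleC_scaleC scaleC_complex_def mult.commute)+

lemma clinear_slice_right: "clinear w \<Longrightarrow> clinear (slice_right w)"
  and slice_right_tens: "clinear w \<Longrightarrow> slice_right w (x \<otimes> y) = w y *\<^sub>C x"
  unfolding slice_right_def by (simp_all add: clinear_tlift tlift_tens cbilinear_slices)

lemma clinear_slice_left: "clinear w \<Longrightarrow> clinear (slice_left w)"
  and slice_left_tens: "clinear w \<Longrightarrow> slice_left w (x \<otimes> y) = w x *\<^sub>C y"
  unfolding slice_left_def by (simp_all add: clinear_tlift tlift_tens cbilinear_slices)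

lemma tensor_basis_form:
  fixes t :: "('a::complex_vector, 'b::complex_vector) tensor"
  assumes B: "cvs.span B = UNIV"
  shows "\<exists>F y. finite F \<and> F \<subseteq> B \<and> t = (\<Sum>e\<in>F. e \<otimes> y e)"
proof (induction t)
  case zero
  show ?case by (rule exI[of _ "{}"]) simp
next
  case (add t x z)
  then obtain F y where F: "finite F" "F \<subseteq> B" "t = (\<Sum>e\<in>F. e \<otimes> y e)" by blast
  have "x \<in> cvs.span B" using B by simp
  then obtain G r where G: "finite G" "G \<subseteq> B" "x = (\<Sum>e\<in>G. r e *\<^sub>C e)"
    unfolding cvs.span_explicit by blast
  have "x \<otimes> z = (\<Sum>e\<in>G. e \<otimes> (r e *\<^sub>C z))"
    unfolding G(3) using G(1) by (induction G) (simp_all add: tens_simps)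
  also have "\<dots> = (\<Sum>e\<in>F \<union> G. e \<otimes> (if e \<in> G then r e *\<^sub>C z else 0))"
    using F(1) G(1) by (intro sum.mono_neutral_cong_left) auto
  finally have xz: "x \<otimes> z = \<dots>" .
  have "t = (\<Sum>e\<in>F \<union> G. e \<otimes> (if e \<in> F then y e else 0))"
    unfolding F(3) using F(1) G(1) by (intro sum.mono_neutral_cong_left) auto
  with xz have "t + x \<otimes> z = (\<Sum>e\<in>F \<union> G. e \<otimes> ((if e \<in> F then y e else 0) + (if e \<in> G then r e *\<^sub>C z else 0)))"
    by (simp add: tens_simps sum.distrib)
  with F G show ?case by (intro exI[of _ "F \<union> G"] exI conjI) auto
qed

lemma slices_separate:
  fixes t :: "('a::complex_vector, 'b::complex_vector) tensor"
  assumes "\<And>w. clinear w \<Longrightarrow> slice_left w t = 0"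
  shows "t = 0"
proof -
  define B :: "'a set" where "B = cvs.extend_basis {}"
  have indep: "cvs.independent B" and span: "cvs.span B = UNIV"
    unfolding B_def by (simp_all add: cvs.independent_extend_basis cvs.span_extend_basis cvs.independent_empty)
  obtain F y where F: "finite F" "F \<subseteq> B" "t = (\<Sum>e\<in>F. e \<otimes> y e)"
    using tensor_basis_form[OF span] by blast
  have "y e = 0" if e: "e \<in> F" for e
  proof -
    define w where "w v = cvs.representation B v e" for v
    have w: "clinear w"
      unfolding w_def by (rule clinearI)
        (simp_all add: cvs.representation_add[OF indep] cvs.representation_scale[OF indep] span scaleC_complex_def)
    have we: "w e' = (if e' = e then 1 else 0)" if "e' \<in> F" for e'
      using F that by (auto simp: w_def cvs.representation_basis[OF indep] subset_iff)
    have "slice_left w t = (\<Sum>e'\<in>F. w e' *\<^sub>C y e')"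
      unfolding F(3) using F(1)
      by (induction F) (simp_all add: clinear_0 clinear_add clinear_slice_left slice_left_tens w)
    also have "\<dots> = (\<Sum>e'\<in>F. if e' = e then y e' else 0)"
      by (rule sum.cong) (auto simp: we scaleC_one)
    also have "\<dots> = y e" using F(1) e by simp
    finally show ?thesis using assms[OF w] by simp
  qed
  then show ?thesis by (simp add: F(3))
qed


section \<open>The tensor product of algebras\<close>

lemma cbilinear_tmult_inner:
  fixes x :: "'a::complex_algebra" and y :: "'b::complex_algebra"
  shows "cbilinear (\<lambda>x' y'. (x * x') \<otimes> (y * y'))"
  by (rule cbilinear_tmap) (rule clinear_mult_left)+

lemma cbilinear_tmult:
  fixes t :: "('a::complex_algebra, 'b::complex_algebra) tensor"
  shows "cbilinear (\<lambda>x y. tlift (\<lambda>x' y'. (x * x') \<otimes> (y * y')) t)"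
  unfolding cbilinear_def
  by (intro allI conjI; rule clinear_tlift_param[OF cbilinear_tmult_inner]; rule clinearI)
    (simp_all add: distrib_right mult_scaleC_left tens_simps)

instantiation tensor :: (complex_algebra, complex_algebra) complex_algebra
begin

definition times_tensor :: "('a, 'b) tensor \<Rightarrow> ('a, 'b) tensor \<Rightarrow> ('a, 'b) tensor" where
  "s * t = tlift (\<lambda>x y. tlift (\<lambda>x' y'. (x * x') \<otimes> (y * y')) t) s"

lemma tens_mult_tens:
  fixes x :: 'a and y :: 'b
  shows "(x \<otimes> y) * (x' \<otimes> y') = (x * x') \<otimes> (y * y')"
  by (simp only: times_tensor_def tlift_tens[OF cbilinear_tmult]) (rule tlift_tens[OF cbilinear_tmult_inner])

lemma tensor_mult_bilinear: "cbilinear ((*) :: ('a, 'b) tensor \<Rightarrow> ('a, 'b) tensor \<Rightarrow> ('a, 'b) tensor)"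
  unfolding cbilinear_def times_tensor_def
  by (intro allI conjI clinear_tlift cbilinear_tmult clinear_tlift_param cbilinear_tmult_inner)

instance
proof
  fix a b c :: "('a, 'b) tensor" and d :: complex
  note m = cbilinear_simps[OF tensor_mult_bilinear]
  show "(a + b) * c = a * c + b * c" "a * (b + c) = a * b + a * c"
    "(d *\<^sub>C a) * b = d *\<^sub>C (a * b)" "a * (d *\<^sub>C b) = d *\<^sub>C (a * b)"
    by (simp_all add: m)
  have m0: "0 * t = 0" "t * 0 = 0" for t :: "('a, 'b) tensor"
    using m(3)[of 0 0 t] m(4)[of t 0 0] by simp_all
  have 1: "(x \<otimes> y * (x' \<otimes> y')) * c = x \<otimes> y * (x' \<otimes> y' * c)" for x x' :: 'a and y y' :: 'b and c
    by (induction c) (simp_all add: m m0 tens_mult_tens mult.assoc)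
  have 2: "(x \<otimes> y * b) * c = x \<otimes> y * (b * c)" for x :: 'a and y :: 'b and b c
    by (induction b) (simp_all add: m m0 1)
  show "a * b * c = a * (b * c)"
    by (induction a) (simp_all add: m m0 2)
qed

end

lemma functionals_separate:
  fixes x :: "'a::complex_vector"
  assumes "\<And>w. clinear w \<Longrightarrow> w x = (0::complex)"
  shows "x = 0"
proof -
  have "x \<otimes> (1::complex) = 0"
    by (rule slices_separate) (simp add: slice_left_tens assms)
  then have "slice_right (\<lambda>z. z) (x \<otimes> (1::complex)) = 0"
    by (simp add: clinear_0 clinear_slice_right clinear_id)
  then show ?thesis by (simp add: slice_right_tens clinear_id scaleC_one)
qed

lemma slice_left_right:
  fixes t :: "('a::complex_vector, 'b::complex_vector) tensor"
  assumes "clinear v" "clinear w"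
  shows "v (slice_left w t) = (w (slice_right v t) :: complex)"
proof (induction t)
  case zero
  show ?case
    by (simp only: clinear_0[OF clinear_slice_left[OF assms(2)]] clinear_0[OF clinear_slice_right[OF assms(1)]]
        clinear_0[OF assms(1)] clinear_0[OF assms(2)])
next
  case (add t x y)
  have "v (slice_left w (x \<otimes> y)) = w (slice_right v (x \<otimes> y))"
    by (simp add: slice_left_tens[OF assms(2)] slice_right_tens[OF assms(1)]
        clinear_scale[OF assms(1)] clinear_scale[OF assms(2)] scaleC_complex_def)
  then show ?case
    by (simp only: add clinear_add[OF clinear_slice_left[OF assms(2)]] clinear_add[OF clinear_slice_right[OF assms(1)]]
        clinear_add[OF assms(1)] clinear_add[OF assms(2)])
qed

lemma clinear_translates:
  fixes x :: "'a::complex_algebra"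
  assumes "clinear w"
  shows "clinear (\<lambda>u. w (u * x))" "clinear (\<lambda>u. w (x * u))"
  using clinear_compose[OF clinear_mult_right assms] clinear_compose[OF clinear_mult_left assms]
  by auto

lemma slice_left_mult:
  fixes s :: "('a::complex_algebra, 'b::complex_algebra) tensor"
  assumes w: "clinear w"
  shows "slice_left w (s * (x \<otimes> y)) = slice_left (\<lambda>u. w (u * x)) s * y"
    "slice_left w ((x \<otimes> y) * s) = y * slice_left (\<lambda>u. w (x * u)) s"
  by (induction s) (simp_all add: w clinear_translates clinear_0 clinear_add clinear_slice_left
      slice_left_tens tens_mult_tens distrib_left distrib_right mult_scaleC_left mult_scaleC_right)

instance tensor :: (nondegenerate_algebra, nondegenerate_algebra) nondegenerate_algebra
proof
  fix t :: "('a, 'b) tensor"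
  show "t = 0" if *: "\<And>s. t * s = 0"
  proof (rule slices_separate, rule functionals_separate)
    fix w :: "'a \<Rightarrow> complex" and v :: "'b \<Rightarrow> complex"
    assume w: "clinear w" and v: "clinear v"
    have "slice_right v t = 0"
    proof (rule nondegenerate_left, rule functionals_separate)
      fix x and w' :: "'a \<Rightarrow> complex" assume w': "clinear w'"
      have "slice_left (\<lambda>u. w' (u * x)) t = 0"
        by (rule nondegenerate_left)
          (simp add: slice_left_mult(1)[OF w', symmetric] * clinear_0 clinear_slice_left w')
      then show "w' (slice_right v t * x) = 0"
        using slice_left_right[OF v clinear_translates(1)[OF w'], of x t] v by (simp add: clinear_0)
    qed
    then show "v (slice_left w t) = 0"
      using w by (simp add: slice_left_right[OF v w] clinear_0)
  qed
  show "t = 0" if *: "\<And>s. s * t = 0"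
  proof (rule slices_separate, rule functionals_separate)
    fix w :: "'a \<Rightarrow> complex" and v :: "'b \<Rightarrow> complex"
    assume w: "clinear w" and v: "clinear v"
    have "slice_right v t = 0"
    proof (rule nondegenerate_right, rule functionals_separate)
      fix x and w' :: "'a \<Rightarrow> complex" assume w': "clinear w'"
      have "slice_left (\<lambda>u. w' (x * u)) t = 0"
        by (rule nondegenerate_right)
          (simp add: slice_left_mult(2)[OF w', symmetric] * clinear_0 clinear_slice_left w')
      then show "w' (x * slice_right v t) = 0"
        using slice_left_right[OF v clinear_translates(2)[OF w'], of x t] v by (simp add: clinear_0)
    qed
    then show "v (slice_left w t) = 0"
      using w by (simp add: slice_left_right[OF v w] clinear_0)
  qed
qed


section \<open>Multiplier algebras\<close>

text \<open>A multiplier is a pair of a left multiplication \<open>x \<mapsto> m x\<close> and a right multiplication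
  \<open>x \<mapsto> x m\<close>. Over a non-degenerate algebra all conditions follow from the last one.\<close>

typedef (overloaded) 'a multiplier = "{(l :: 'a::complex_algebra \<Rightarrow> 'a, r :: 'a \<Rightarrow> 'a).
    clinear l \<and> clinear r \<and> (\<forall>x y. l (x * y) = l x * y) \<and> (\<forall>x y. r (x * y) = x * r y) \<and>
    (\<forall>x y. r x * y = x * l y)}"
  by (rule exI[of _ "(\<lambda>x. x, \<lambda>x. x)"]) (simp add: clinear_id)

setup_lifting type_definition_multiplier

lift_definition mleft :: "'a::complex_algebra multiplier \<Rightarrow> 'a \<Rightarrow> 'a" is fst .
lift_definition mright :: "'a::complex_algebra \<Rightarrow> 'a multiplier \<Rightarrow> 'a" is "\<lambda>x m. snd m x" .

lemma clinear_mleft: "clinear (mleft m)"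
  and clinear_mright: "clinear (\<lambda>x. mright x m)"
  and mleft_mult: "mleft m (x * y) = mleft m x * y"
  and mright_mult: "mright (x * y) m = x * mright y m"
  and mright_mleft: "mright x m * y = x * mleft m y"
  by (transfer; auto)+

lemma multiplier_eqI: "mleft m = mleft n \<Longrightarrow> (\<And>x. mright x m = mright x n) \<Longrightarrow> m = n"
  by transfer (auto simp: fun_eq_iff)

instantiation multiplier :: (complex_algebra) complex_algebra
begin

lift_definition zero_multiplier :: "'a multiplier" is "(\<lambda>x. 0, \<lambda>x. 0)"
  by (auto intro: clinearI)

lift_definition plus_multiplier :: "'a multiplier \<Rightarrow> 'a multiplier \<Rightarrow> 'a multiplier"
  is "\<lambda>(l, r) (l', r'). (\<lambda>x. l x + l' x, \<lambda>x. r x + r' x)"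
  by (auto intro!: clinear_plus simp: distrib_left distrib_right)

lift_definition scaleC_multiplier :: "complex \<Rightarrow> 'a multiplier \<Rightarrow> 'a multiplier"
  is "\<lambda>c (l, r). (\<lambda>x. c *\<^sub>C l x, \<lambda>x. c *\<^sub>C r x)"
  by (auto intro!: clinear_smult simp: mult_scaleC_left mult_scaleC_right)

definition uminus_multiplier :: "'a multiplier \<Rightarrow> 'a multiplier" where
  "uminus_multiplier m = (- 1) *\<^sub>C m"

definition minus_multiplier :: "'a multiplier \<Rightarrow> 'a multiplier \<Rightarrow> 'a multiplier" where
  "minus_multiplier m n = m + (- n)"

lift_definition times_multiplier :: "'a multiplier \<Rightarrow> 'a multiplier \<Rightarrow> 'a multiplier"
  is "\<lambda>(l, r) (l', r'). (\<lambda>x. l (l' x), \<lambda>x. r' (r x))"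
  by (auto intro: clinear_compose)

lemma mleft_simps:
  "mleft 0 x = (0::'a)" "mleft (m + n) x = mleft m x + mleft n x" "mleft (c *\<^sub>C m) x = c *\<^sub>C mleft m x"
  "mleft (m * n) x = mleft m (mleft n x)"
  for x :: 'a
  by (transfer; auto)+

lemma mright_simps:
  "mright x 0 = (0::'a)" "mright x (m + n) = mright x m + mright x n" "mright x (c *\<^sub>C m) = c *\<^sub>C mright x m"
  "mright x (m * n) = mright (mright x m) n"
  for x :: 'a
  by (transfer; auto)+

instance
proof
  fix a b c :: "'a multiplier" and x y :: complex
  note simps = mleft_simps mright_simps clinear_add[OF clinear_mleft] clinear_add[OF clinear_mright]
    clinear_scale[OF clinear_mleft] clinear_scale[OF clinear_mright] algebra_simps
    scaleC_add_right scaleC_add_left scaleC_scaleC scaleC_one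
    uminus_multiplier_def
  show "a + b + c = a + (b + c)" "a + b = b + a" "0 + a = a" "- a + a = 0"
    "(a + b) * c = a * c + b * c" "a * (b + c) = a * b + a * c" "a * b * c = a * (b * c)"
    "x *\<^sub>C (a + b) = x *\<^sub>C a + x *\<^sub>C b" "(x + y) *\<^sub>C a = x *\<^sub>C a + y *\<^sub>C a"
    "x *\<^sub>C y *\<^sub>C a = (x * y) *\<^sub>C a" "1 *\<^sub>C a = a"
    "(x *\<^sub>C a) * b = x *\<^sub>C (a * b)" "a * (x *\<^sub>C b) = x *\<^sub>C (a * b)"
    by (rule multiplier_eqI; simp add: fun_eq_iff simps)+
  show "a - b = a + - b" by (rule minus_multiplier_def)
qed

end

instantiation multiplier :: (complex_algebra) monoid_mult
begin

lift_definition one_multiplier :: "'a multiplier" is "(\<lambda>x. x, \<lambda>x. x)"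
  by (simp add: clinear_id)

lemma mleft_one: "mleft 1 x = (x :: 'a)" and mright_one: "mright x 1 = (x :: 'a)"
  by (transfer; simp)+

instance
  by standard (rule multiplier_eqI; simp add: fun_eq_iff mleft_simps mright_simps mleft_one mright_one)+

end

lift_definition of_alg :: "'a::complex_algebra \<Rightarrow> 'a multiplier"
  is "\<lambda>x. ((*) x, \<lambda>y. y * x)"
  by (auto simp: mult.assoc clinear_mult_left clinear_mult_right)

text \<open>The algebra element that a multiplier in the range of \<^const>\<open>of_alg\<close> stands for.\<close>

definition to_alg :: "'a::complex_algebra multiplier \<Rightarrow> 'a" where
  "to_alg m = (THE x. of_alg x = m)"

lemma mleft_of_alg: "mleft (of_alg x) y = x * y" and mright_of_alg: "mright y (of_alg x) = y * x"
  by (transfer; simp)+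

lemma of_alg_eq_iff: "of_alg x = of_alg y \<longleftrightarrow> x = y" for x y :: "'a::nondegenerate_algebra"
proof
  assume "of_alg x = of_alg y"
  then have "mleft (of_alg x) z = mleft (of_alg y) z" for z by simp
  then have "(x - y) * z = 0" for z by (simp add: mleft_of_alg left_diff_distrib)
  then have "x - y = 0" by (rule nondegenerate_left)
  then show "x = y" by simp
qed simp

lemma to_alg_of_alg [simp]: "to_alg (of_alg x) = x" for x :: "'a::nondegenerate_algebra"
  unfolding to_alg_def by (rule the_equality) (simp_all add: of_alg_eq_iff)

lemma of_alg_to_alg: "m \<in> range of_alg \<Longrightarrow> of_alg (to_alg m) = m" for m :: "'a::nondegenerate_algebra multiplier"
  by auto

lemma of_alg_add: "of_alg (x + y) = of_alg x + of_alg y"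
  and of_alg_scale: "of_alg (c *\<^sub>C x) = c *\<^sub>C of_alg x"
  and of_alg_mult: "of_alg (x * y) = of_alg x * of_alg y"
  and of_alg_mleft: "of_alg (mleft m x) = m * of_alg x"
  and of_alg_mright: "of_alg (mright x m) = of_alg x * m"
  by (rule multiplier_eqI; simp add: fun_eq_iff mleft_simps mright_simps mleft_of_alg mright_of_alg
      algebra_simps mult_scaleC_left mult_scaleC_right mleft_mult mright_mult mright_mleft)+

lemma clinear_of_alg: "clinear of_alg"
  by (rule clinearI) (simp_all add: of_alg_add of_alg_scale)

text \<open>The image of \<open>m \<otimes> n\<close> under \<open>M(A) \<otimes> M(B) \<rightarrow> M(A \<otimes> B)\<close>.\<close>

lift_definition mtens :: "'a::complex_algebra multiplier \<Rightarrow> 'b::complex_algebra multiplier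
    \<Rightarrow> ('a, 'b) tensor multiplier" (infixl "\<otimes>\<^sub>M" 73)
  is "\<lambda>(l, r) (l', r'). (tmap l l', tmap r r')"
proof clarsimp
  fix l r :: "'a \<Rightarrow> 'a" and l' r' :: "'b \<Rightarrow> 'b"
  assume lin: "clinear l" "clinear l'" "clinear r" "clinear r'"
    and l: "\<forall>x y. l (x * y) = l x * y" and r: "\<forall>x y. r (x * y) = x * r y"
    and c: "\<forall>x y. r x * y = x * l y"
    and l': "\<forall>x y. l' (x * y) = l' x * y" and r': "\<forall>x y. r' (x * y) = x * r' y"
    and c': "\<forall>x y. r' x * y = x * l' y"
  note L = clinear_tmap[OF lin(1,2)] and R = clinear_tmap[OF lin(3,4)]
  note T = tmap_tens[OF lin(1,2)] tmap_tens[OF lin(3,4)]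
  note S = clinear_0[OF L] clinear_0[OF R] clinear_add[OF L] clinear_add[OF R] T
    distrib_left distrib_right tens_mult_tens
  have "tmap l l' (s * t) = tmap l l' s * t" for s t
  proof (induction s)
    case (add s x y)
    have "tmap l l' (x \<otimes> y * t) = tmap l l' (x \<otimes> y) * t"
      by (induction t) (simp_all add: S l l')
    with add show ?case by (simp add: S)
  qed (simp add: S)
  moreover have "tmap r r' (s * t) = s * tmap r r' t" for s t
  proof (induction s)
    case (add s x y)
    have "tmap r r' (x \<otimes> y * t) = x \<otimes> y * tmap r r' t"
      by (induction t) (simp_all add: S r r')
    with add show ?case by (simp add: S)
  qed (simp add: S)
  moreover have "tmap r r' s * t = s * tmap l l' t" for s t
  proof (induction s)
    case (add s x y)
    have "tmap r r' (x \<otimes> y) * t = x \<otimes> y * tmap l l' t"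
      by (induction t) (simp_all add: S c c')
    with add show ?case by (simp add: S)
  qed (simp add: S)
  ultimately show "clinear (tmap l l') \<and> clinear (tmap r r') \<and>
      (\<forall>x y. tmap l l' (x * y) = tmap l l' x * y) \<and> (\<forall>x y. tmap r r' (x * y) = x * tmap r r' y) \<and>
      (\<forall>x y. tmap r r' x * y = x * tmap l l' y)"
    using L R by blast
qed

lemma mleft_mtens_tmap: "mleft (m \<otimes>\<^sub>M n) = tmap (mleft m) (mleft n)"
  and mright_mtens_tmap: "mright t (m \<otimes>\<^sub>M n) = tmap (\<lambda>x. mright x m) (\<lambda>x. mright x n) t"
  by (transfer; simp only: case_prod_beta fst_conv snd_conv)+

lemma mleft_mtens: "mleft (m \<otimes>\<^sub>M n) (x \<otimes> y) = mleft m x \<otimes> mleft n y"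
  and mright_mtens: "mright (x \<otimes> y) (m \<otimes>\<^sub>M n) = mright x m \<otimes> mright y n"
  by (simp_all add: mleft_mtens_tmap mright_mtens_tmap tmap_tens clinear_mleft clinear_mright)

lemma tensor_multiplier_eqI:
  fixes m n :: "('a::complex_algebra, 'b::complex_algebra) tensor multiplier"
  assumes "\<And>x y. mleft m (x \<otimes> y) = mleft n (x \<otimes> y)" "\<And>x y. mright (x \<otimes> y) m = mright (x \<otimes> y) n"
  shows "m = n"
proof (rule multiplier_eqI)
  show "mleft m = mleft n"
    by (rule ext) (rule tensor_eqI[OF clinear_mleft clinear_mleft assms(1)])
  show "mright t m = mright t n" for t
    by (rule tensor_eqI[OF clinear_mright clinear_mright assms(2)])
qed

lemma cbilinear_mtens: "cbilinear (\<otimes>\<^sub>M)"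
  by (rule cbilinearI; rule tensor_multiplier_eqI)
    (simp_all add: mleft_mtens mright_mtens mleft_simps mright_simps tens_simps)

lemma mtens_mult: "(m \<otimes>\<^sub>M n) * (m' \<otimes>\<^sub>M n') = (m * m') \<otimes>\<^sub>M (n * n')"
  by (rule tensor_multiplier_eqI) (simp_all add: mleft_mtens mright_mtens mleft_simps mright_simps)

lemma of_alg_tens: "of_alg (x \<otimes> y) = of_alg x \<otimes>\<^sub>M of_alg y"
  by (rule tensor_multiplier_eqI)
    (simp_all add: mleft_mtens mright_mtens mleft_of_alg mright_of_alg tens_mult_tens)

lemma tflip_mult: "tflip (s * t) = tflip s * tflip t"
proof (induction s)
  case (add s x y)
  have "tflip (x \<otimes> y * t) = tflip (x \<otimes> y) * tflip t"
    by (induction t) (simp_all add: clinear_0 clinear_add clinear_tflip tflip_tens tens_mult_tens distrib_left)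
  with add show ?case by (simp add: clinear_add clinear_tflip distrib_right)
qed (simp add: clinear_0 clinear_tflip)

lift_definition mflip :: "('a::complex_algebra, 'b::complex_algebra) tensor multiplier
    \<Rightarrow> ('b, 'a) tensor multiplier"
  is "\<lambda>(l, r). (\<lambda>t. tflip (l (tflip t)), \<lambda>t. tflip (r (tflip t)))"
proof clarsimp
  fix l r :: "('a, 'b) tensor \<Rightarrow> ('a, 'b) tensor"
  assume lr: "clinear l" "clinear r" "\<forall>x y. l (x * y) = l x * y" "\<forall>x y. r (x * y) = x * r y"
    "\<forall>x y. r x * y = x * l y"
  have "tflip (r (tflip x)) * y = x * tflip (l (tflip y))" for x y
    using lr(5) tflip_mult tflip_tflip by metis
  then show "clinear (\<lambda>t. tflip (l (tflip t))) \<and> clinear (\<lambda>t. tflip (r (tflip t))) \<and>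
      (\<forall>x y. tflip (l (tflip (x * y))) = tflip (l (tflip x)) * y) \<and>
      (\<forall>x y. tflip (r (tflip (x * y))) = x * tflip (r (tflip y))) \<and>
      (\<forall>x y. tflip (r (tflip x)) * y = x * tflip (l (tflip y)))"
    using lr by (auto simp: tflip_mult tflip_tflip
        intro!: clinear_compose[OF clinear_tflip clinear_compose[OF _ clinear_tflip]])
qed

lemma mleft_mflip: "mleft (mflip m) t = tflip (mleft m (tflip t))"
  and mright_mflip: "mright t (mflip m) = tflip (mright (tflip t) m)"
  by (transfer; simp only: case_prod_beta fst_conv snd_conv)+


lemma mflip_mult: "mflip (m * n) = mflip m * mflip n"
  by (rule multiplier_eqI) (simp_all add: fun_eq_iff mleft_mflip mright_mflip mleft_simps mright_simps tflip_tflip)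

lemma mflip_mflip: "mflip (mflip m) = m"
  by (rule multiplier_eqI) (simp_all add: fun_eq_iff mleft_mflip mright_mflip tflip_tflip)

lemma mflip_mtens: "mflip (m \<otimes>\<^sub>M n) = n \<otimes>\<^sub>M m"
  by (rule tensor_multiplier_eqI) (simp_all add: mleft_mflip mright_mflip mleft_mtens mright_mtens tflip_tens)

lemma of_alg_tflip: "of_alg (tflip t) = mflip (of_alg t)"
  by (rule multiplier_eqI)
    (simp_all add: fun_eq_iff mleft_mflip mright_mflip mleft_of_alg mright_of_alg tflip_mult tflip_tflip)


section \<open>Algebraic quantum groups\<close>

text \<open>The maps \<open>a \<otimes> a' \<mapsto> \<Delta>(a)(1 \<otimes> a')\<close> and \<open>a \<otimes> a' \<mapsto> (a \<otimes> 1)\<Delta>(a')\<close>.\<close>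

definition canonical_map1 :: "('a::complex_algebra \<Rightarrow> ('a, 'a) tensor multiplier) \<Rightarrow> ('a, 'a) tensor \<Rightarrow> ('a, 'a) tensor" where
  "canonical_map1 D = tlift (\<lambda>a a'. to_alg (D a * (1 \<otimes>\<^sub>M of_alg a')))"

definition canonical_map2 :: "('a::complex_algebra \<Rightarrow> ('a, 'a) tensor multiplier) \<Rightarrow> ('a, 'a) tensor \<Rightarrow> ('a, 'a) tensor" where
  "canonical_map2 D = tlift (\<lambda>a a'. to_alg ((of_alg a \<otimes>\<^sub>M 1) * D a'))"

text \<open>\<open>D \<otimes> \<iota>\<close> and \<open>\<iota> \<otimes> D\<close> on \<open>A \<otimes> A\<close>.\<close>

definition comult_id :: "('a::complex_algebra \<Rightarrow> ('a, 'a) tensor multiplier)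
    \<Rightarrow> ('a, 'a) tensor \<Rightarrow> (('a, 'a) tensor, 'a) tensor multiplier" where
  "comult_id D = tlift (\<lambda>x y. D x \<otimes>\<^sub>M of_alg y)"

definition id_comult :: "('a::complex_algebra \<Rightarrow> ('a, 'a) tensor multiplier)
    \<Rightarrow> ('a, 'a) tensor \<Rightarrow> ('a, ('a, 'a) tensor) tensor multiplier" where
  "id_comult D = tlift (\<lambda>x y. of_alg x \<otimes>\<^sub>M D y)"

text \<open>The two sides of coassociativity are multipliers of \<open>(A \<otimes> A) \<otimes> A\<close> and of \<open>A \<otimes> (A \<otimes> A)\<close>; they
  are compared along the isomorphism \<^const>\<open>tassoc\<close>.\<close>

definition coassociative :: "('a::complex_algebra \<Rightarrow> ('a, 'a) tensor multiplier) \<Rightarrow> bool" where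
  "coassociative D \<longleftrightarrow> (\<forall>a c a'.
    let m = ((of_alg a \<otimes>\<^sub>M 1) \<otimes>\<^sub>M 1) * comult_id D (to_alg (D c * (1 \<otimes>\<^sub>M of_alg a')));
        n = id_comult D (to_alg ((of_alg a \<otimes>\<^sub>M 1) * D c)) * (1 \<otimes>\<^sub>M (1 \<otimes>\<^sub>M of_alg a'))
    in \<forall>t. tassoc (mleft m t) = mleft n (tassoc t) \<and> tassoc (mright t m) = mright (tassoc t) n)"

definition regular_multiplier_Hopf :: "('a::nondegenerate_algebra \<Rightarrow> ('a, 'a) tensor multiplier) \<Rightarrow> bool" where
  "regular_multiplier_Hopf D \<longleftrightarrow>
    clinear D \<and> (\<forall>a a'. D (a * a') = D a * D a') \<and>
    (\<forall>a a'. D a * (1 \<otimes>\<^sub>M of_alg a') \<in> range of_alg \<and> (of_alg a \<otimes>\<^sub>M 1) * D a' \<in> range of_alg \<and>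
      D a * (of_alg a' \<otimes>\<^sub>M 1) \<in> range of_alg \<and> (1 \<otimes>\<^sub>M of_alg a) * D a' \<in> range of_alg) \<and>
    coassociative D \<and>
    bij (canonical_map1 D) \<and> bij (canonical_map2 D) \<and>
    bij (canonical_map1 (\<lambda>a. mflip (D a))) \<and> bij (canonical_map2 (\<lambda>a. mflip (D a)))"

text \<open>\<open>(\<iota> \<otimes> \<omega>)(m) = n\<close> and \<open>(\<omega> \<otimes> \<iota>)(m) = n\<close> in \<open>M(A)\<close>, for \<open>m \<in> M(A \<otimes> A)\<close> such that multiplying
  \<open>m\<close> by \<open>c \<otimes> 1\<close>, respectively \<open>1 \<otimes> c\<close>, on either side gives elements of \<open>A \<otimes> A\<close>.\<close>

definition is_slice_right ::
  "('a::complex_algebra \<Rightarrow> complex) \<Rightarrow> ('a, 'a) tensor multiplier \<Rightarrow> 'a multiplier \<Rightarrow> bool" where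
  "is_slice_right w m n \<longleftrightarrow> (\<forall>c.
    mleft n c = slice_right w (to_alg (m * (of_alg c \<otimes>\<^sub>M 1))) \<and>
    mright c n = slice_right w (to_alg ((of_alg c \<otimes>\<^sub>M 1) * m)))"

definition is_slice_left ::
  "('a::complex_algebra \<Rightarrow> complex) \<Rightarrow> ('a, 'a) tensor multiplier \<Rightarrow> 'a multiplier \<Rightarrow> bool" where
  "is_slice_left w m n \<longleftrightarrow> (\<forall>c.
    mleft n c = slice_left w (to_alg (m * (1 \<otimes>\<^sub>M of_alg c))) \<and>
    mright c n = slice_left w (to_alg ((1 \<otimes>\<^sub>M of_alg c) * m)))"

definition left_integral ::
  "('a::complex_algebra \<Rightarrow> ('a, 'a) tensor multiplier) \<Rightarrow> ('a \<Rightarrow> complex) \<Rightarrow> bool" where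
  "left_integral D w \<longleftrightarrow> clinear w \<and> (\<exists>a. w a \<noteq> 0) \<and> (\<forall>a. is_slice_right w (D a) (w a *\<^sub>C 1))"

definition right_integral ::
  "('a::complex_algebra \<Rightarrow> ('a, 'a) tensor multiplier) \<Rightarrow> ('a \<Rightarrow> complex) \<Rightarrow> bool" where
  "right_integral D w \<longleftrightarrow> clinear w \<and> (\<exists>a. w a \<noteq> 0) \<and> (\<forall>a. is_slice_left w (D a) (w a *\<^sub>C 1))"

class algebraic_quantum_group =
  fixes comult :: "'a::nondegenerate_algebra \<Rightarrow> ('a, 'a) tensor multiplier"
    and lint :: "'a \<Rightarrow> complex"
  assumes regular_multiplier_Hopf: "regular_multiplier_Hopf comult"
    and left_integral: "left_integral comult lint"
    and right_integral_exists: "\<exists>w. right_integral comult w"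

lemma comult_mult: "comult (a * a') = comult a * comult a'"
  and clinear_comult: "clinear comult"
  and coassociative_comult: "coassociative comult"
  using regular_multiplier_Hopf unfolding regular_multiplier_Hopf_def by blast+

lemma comult_range:
  fixes a a' :: "'a::algebraic_quantum_group"
  shows "comult a * (1 \<otimes>\<^sub>M of_alg a') \<in> range of_alg" "(of_alg a \<otimes>\<^sub>M 1) * comult a' \<in> range of_alg"
    "comult a * (of_alg a' \<otimes>\<^sub>M 1) \<in> range of_alg" "(1 \<otimes>\<^sub>M of_alg a) * comult a' \<in> range of_alg"
  using regular_multiplier_Hopf[where 'a='a] unfolding regular_multiplier_Hopf_def by blast+

lemma clinear_lint: "clinear lint"
  using left_integral unfolding left_integral_def by blast

lemma slice_comult:
  "slice_right lint (to_alg (comult a * (of_alg c \<otimes>\<^sub>M 1))) = lint a *\<^sub>C c"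
proof -
  have "mleft (lint a *\<^sub>C 1) c = slice_right lint (to_alg (comult a * (of_alg c \<otimes>\<^sub>M 1)))"
    using left_integral unfolding left_integral_def is_slice_right_def by blast
  then show ?thesis by (simp add: mleft_simps mleft_one)
qed

lemma cbilinear_to_alg:
  fixes f :: "'a::complex_vector \<Rightarrow> 'b::complex_vector \<Rightarrow> 'c::nondegenerate_algebra multiplier"
  assumes f: "cbilinear f" and r: "\<And>x y. f x y \<in> range of_alg"
  shows "cbilinear (\<lambda>x y. to_alg (f x y))"
proof -
  define g where "g x y = to_alg (f x y)" for x y
  have g: "f x y = of_alg (g x y)" for x y
    unfolding g_def by (rule of_alg_to_alg[OF r, symmetric])
  have "cbilinear g"
    by (rule cbilinearI; rule of_alg_eq_iff[THEN iffD1])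
      (simp_all only: of_alg_add of_alg_scale g[symmetric] cbilinear_simps[OF f])
  then show ?thesis by (simp add: g)
qed

lemma cbilinear_mult_maps:
  fixes g :: "'a::complex_vector \<Rightarrow> 'c::complex_algebra"
  assumes "clinear g" "clinear h"
  shows "cbilinear (\<lambda>x y. g x * h y)"
  by (rule cbilinear_compose[OF cbilinear_mult assms])

lemma clinear_mtens: "clinear (\<lambda>x. m \<otimes>\<^sub>M x)" "clinear (\<lambda>x. x \<otimes>\<^sub>M n)"
  using cbilinear_mtens unfolding cbilinear_def by auto

lemma cbilinear_canonical_map1:
  fixes D :: "'a::nondegenerate_algebra \<Rightarrow> ('a, 'a) tensor multiplier"
  assumes "clinear D" "\<And>a a'. D a * (1 \<otimes>\<^sub>M of_alg a') \<in> range of_alg"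
  shows "cbilinear (\<lambda>a a'. to_alg (D a * (1 \<otimes>\<^sub>M of_alg a')))"
  by (intro cbilinear_to_alg cbilinear_mult_maps assms clinear_compose[OF clinear_of_alg clinear_mtens(1)])

lemma of_alg_canonical_map1:
  fixes D :: "'a::nondegenerate_algebra \<Rightarrow> ('a, 'a) tensor multiplier"
  assumes "clinear D" "\<And>a a'. D a * (1 \<otimes>\<^sub>M of_alg a') \<in> range of_alg"
  shows "of_alg (canonical_map1 D (a \<otimes> a')) = D a * (1 \<otimes>\<^sub>M of_alg a')"
  unfolding canonical_map1_def tlift_tens[OF cbilinear_canonical_map1[OF assms]]
  by (rule of_alg_to_alg[OF assms(2)])

lemma slice_right_mult:
  fixes t :: "('a::complex_algebra, 'b::complex_algebra) tensor"
  assumes "clinear w"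
  shows "slice_right w (mright t (of_alg c \<otimes>\<^sub>M 1)) = slice_right w t * c"
    and "slice_right w (mleft (of_alg c \<otimes>\<^sub>M 1) t) = c * slice_right w t"
    and "slice_right w (mright t (1 \<otimes>\<^sub>M of_alg d)) = slice_right (\<lambda>u. w (u * d)) t"
proof -
  note S = clinear_0[OF clinear_mleft] clinear_0[OF clinear_mright] clinear_add[OF clinear_mleft]
    clinear_add[OF clinear_mright] clinear_0[OF clinear_slice_right[OF assms]]
    clinear_add[OF clinear_slice_right[OF assms]] slice_right_tens[OF assms]
    clinear_0[OF clinear_slice_right[OF clinear_translates(1)[OF assms]]]
    clinear_add[OF clinear_slice_right[OF clinear_translates(1)[OF assms]]]
    slice_right_tens[OF clinear_translates(1)[OF assms]]
    mleft_mtens mright_mtens mleft_of_alg mright_of_alg mleft_one mright_one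
    distrib_left distrib_right mult_scaleC_left mult_scaleC_right
  show "slice_right w (mright t (of_alg c \<otimes>\<^sub>M 1)) = slice_right w t * c"
    by (induction t) (simp_all add: S)
  show "slice_right w (mleft (of_alg c \<otimes>\<^sub>M 1) t) = c * slice_right w t"
    by (induction t) (simp_all add: S)
  show "slice_right w (mright t (1 \<otimes>\<^sub>M of_alg d)) = slice_right (\<lambda>u. w (u * d)) t"
    by (induction t) (simp_all add: S)
qed

text \<open>\<open>conv_slice a c = (\<iota> \<otimes> \<phi>)(\<Delta>(a)(1 \<otimes> c))\<close>\<close>

definition conv_slice :: "'a::algebraic_quantum_group \<Rightarrow> 'a \<Rightarrow> 'a" where
  "conv_slice a c = slice_right lint (to_alg (comult a * (1 \<otimes>\<^sub>M of_alg c)))"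

text \<open>\<open>\<phi> \<otimes> \<phi>\<close>\<close>

definition lint2 :: "('a::algebraic_quantum_group, 'a) tensor \<Rightarrow> complex" where
  "lint2 = tlift (\<lambda>x y. lint x * lint y)"

lemma cbilinear_lint2: "cbilinear (\<lambda>x y. lint x * lint y)"
  by (rule cbilinearI) (simp_all add: clinear_add[OF clinear_lint] clinear_scale[OF clinear_lint]
      scaleC_complex_def algebra_simps)

lemma clinear_lint2: "clinear lint2"
  and lint2_tens: "lint2 (x \<otimes> y) = lint x * lint y"
  unfolding lint2_def by (simp_all add: clinear_tlift tlift_tens cbilinear_lint2)

lemma lint2_slice: "lint2 t = lint (slice_right lint t)"
  by (rule tensor_eqI[OF clinear_lint2 clinear_compose[OF clinear_slice_right[OF clinear_lint] clinear_lint]])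
    (simp add: lint2_tens slice_right_tens[OF clinear_lint] clinear_scale[OF clinear_lint] scaleC_complex_def)

lemma lint2_comult: "lint2 (mleft (comult a) (c \<otimes> c')) = lint (conv_slice a c' * c)"
proof -
  define E where "E = to_alg (comult a * (1 \<otimes>\<^sub>M of_alg c'))"
  have E: "of_alg E = comult a * (1 \<otimes>\<^sub>M of_alg c')"
    unfolding E_def by (rule of_alg_to_alg[OF comult_range(1)])
  have "of_alg (mleft (comult a) (c \<otimes> c')) = comult a * ((1 \<otimes>\<^sub>M of_alg c') * (of_alg c \<otimes>\<^sub>M 1))"
    by (simp add: of_alg_mleft of_alg_tens mtens_mult)
  also have "\<dots> = of_alg (mright E (of_alg c \<otimes>\<^sub>M 1))"
    by (simp add: of_alg_mright E mult.assoc)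
  finally have "mleft (comult a) (c \<otimes> c') = mright E (of_alg c \<otimes>\<^sub>M 1)"
    by (simp add: of_alg_eq_iff)
  then show ?thesis
    by (simp add: lint2_slice slice_right_mult(1)[OF clinear_lint] conv_slice_def E_def)
qed

lemma mult_conv_slice:
  "e * conv_slice a c = slice_right (\<lambda>u. lint (u * c)) (to_alg ((of_alg e \<otimes>\<^sub>M 1) * comult a))"
proof -
  define E F where "E = to_alg (comult a * (1 \<otimes>\<^sub>M of_alg c))"
    and "F = to_alg ((of_alg e \<otimes>\<^sub>M 1) * comult a)"
  have E: "of_alg E = comult a * (1 \<otimes>\<^sub>M of_alg c)" and F: "of_alg F = (of_alg e \<otimes>\<^sub>M 1) * comult a"
    unfolding E_def F_def by (rule of_alg_to_alg[OF comult_range(1)], rule of_alg_to_alg[OF comult_range(2)])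
  have "of_alg (mleft (of_alg e \<otimes>\<^sub>M 1) E) = of_alg (mright F (1 \<otimes>\<^sub>M of_alg c))"
    by (simp add: of_alg_mleft of_alg_mright E F mult.assoc)
  then have "mleft (of_alg e \<otimes>\<^sub>M 1) E = mright F (1 \<otimes>\<^sub>M of_alg c)"
    by (simp add: of_alg_eq_iff)
  then show ?thesis
    using slice_right_mult(2,3)[OF clinear_lint] by (metis conv_slice_def E_def F_def)
qed

lemma conv_slice_cong:
  assumes "(\<lambda>u. lint (u * c)) = (\<lambda>u. lint (u * d))"
  shows "conv_slice a c = conv_slice a d"
proof -
  have "e * (conv_slice a c - conv_slice a d) = 0" for e
    by (simp add: right_diff_distrib mult_conv_slice assms)
  then have "conv_slice a c - conv_slice a d = 0" by (rule nondegenerate_right)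
  then show ?thesis by simp
qed

lemma lint2_comult_density:
  "\<exists>d. \<forall>a. lint2 (mleft (comult a) t) = lint (a * d)" for t :: "('a::algebraic_quantum_group, 'a) tensor"
proof -
  let ?D = "\<lambda>a :: 'a. mflip (comult a)"
  have lin: "clinear ?D"
    by (rule clinearI; rule multiplier_eqI) (simp_all add: fun_eq_iff mleft_mflip mright_mflip mleft_simps
        mright_simps clinear_add[OF clinear_tflip] clinear_scale[OF clinear_tflip]
        clinear_add[OF clinear_comult] clinear_scale[OF clinear_comult])
  have flip: "?D a * (1 \<otimes>\<^sub>M of_alg a') = mflip (comult a * (of_alg a' \<otimes>\<^sub>M 1))" for a a' :: 'a
    by (simp add: mflip_mult mflip_mtens)
  have ran: "?D a * (1 \<otimes>\<^sub>M of_alg a') \<in> range of_alg" for a a' :: 'a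
    unfolding flip using comult_range(3)[of a a'] by (auto simp: of_alg_tflip[symmetric])
  note can = clinear_tlift[OF cbilinear_canonical_map1[OF lin ran], folded canonical_map1_def]
  have "\<exists>d. \<forall>a. lint2 (mleft (comult a) (tflip (canonical_map1 ?D s))) = lint (a * d)" for s
  proof (induction s)
    case zero
    show ?case
      by (rule exI[of _ 0]) (simp add: clinear_0[OF can] clinear_0[OF clinear_tflip]
          clinear_0[OF clinear_mleft] clinear_0[OF clinear_lint2] clinear_0[OF clinear_lint])
  next
    case (add s p q)
    then obtain d where d: "\<forall>a. lint2 (mleft (comult a) (tflip (canonical_map1 ?D s))) = lint (a * d)" by blast
    define z where "z = tflip (canonical_map1 ?D (p \<otimes> q))"
    have z: "of_alg z = comult p * (of_alg q \<otimes>\<^sub>M 1)"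
      unfolding z_def of_alg_tflip of_alg_canonical_map1[OF lin ran] flip mflip_mflip ..
    have "lint2 (mleft (comult a) z) = lint (a * (lint q *\<^sub>C p))" for a
    proof -
      have "of_alg (mleft (comult a) z) = comult (a * p) * (of_alg q \<otimes>\<^sub>M 1)"
        by (simp add: of_alg_mleft z comult_mult mult.assoc)
      then have "mleft (comult a) z = to_alg (comult (a * p) * (of_alg q \<otimes>\<^sub>M 1))"
        by (metis to_alg_of_alg)
      then show ?thesis
        by (simp add: lint2_slice slice_comult clinear_scale[OF clinear_lint] mult_scaleC_right
            scaleC_complex_def mult.commute)
    qed
    with d have "lint2 (mleft (comult a) (tflip (canonical_map1 ?D (s + p \<otimes> q)))) = lint (a * (d + lint q *\<^sub>C p))" for a
      by (simp add: clinear_add[OF can] clinear_add[OF clinear_tflip] clinear_add[OF clinear_mleft]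
          clinear_add[OF clinear_lint2] z_def[symmetric] distrib_left clinear_add[OF clinear_lint])
    then show ?case by blast
  qed
  moreover have "bij (canonical_map1 ?D)"
    using regular_multiplier_Hopf[where 'a='a] unfolding regular_multiplier_Hopf_def by blast
  then obtain s where "canonical_map1 ?D s = tflip t" by (metis bij_is_surj surjD)
  ultimately show ?thesis by (metis tflip_tflip)
qed


lemma conv_slice_conv_slice:
  assumes d: "\<And>a. lint2 (mleft (comult a) (c' \<otimes> c'')) = lint (a * d)"
  shows "conv_slice a d = conv_slice (conv_slice a c'') c'"
proof -
  have "e * conv_slice a d = e * conv_slice (conv_slice a c'') c'" for e
  proof -
    define F where "F = to_alg ((of_alg e \<otimes>\<^sub>M 1) * comult a)"
    define G where "G = to_alg (comult a * (1 \<otimes>\<^sub>M of_alg c''))"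
    define f where "f u v = to_alg ((of_alg e \<otimes>\<^sub>M 1) * comult u) \<otimes> v" for u v :: 'a
    define g where "g p q = p \<otimes> to_alg (comult q * (1 \<otimes>\<^sub>M of_alg c''))" for p q :: 'a
    have lin2: "clinear (\<lambda>u. to_alg ((of_alg e \<otimes>\<^sub>M 1) * comult u))"
      using cbilinear_to_alg[OF cbilinear_mult_maps[OF clinear_compose[OF clinear_of_alg clinear_mtens(2)] clinear_comult]
          comult_range(2)] unfolding cbilinear_def by blast
    have lin1: "clinear (\<lambda>q. to_alg (comult q * (1 \<otimes>\<^sub>M of_alg c'')))"
      using cbilinear_canonical_map1[OF clinear_comult comult_range(1)] unfolding cbilinear_def by blast
    have f: "cbilinear f"
      unfolding f_def by (rule cbilinear_compose[OF cbilinear_tens lin2 clinear_id])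
    have g: "cbilinear g"
      unfolding g_def by (rule cbilinear_compose[OF cbilinear_tens clinear_id lin1])
    have cid: "cbilinear (\<lambda>(x :: 'a) (y :: 'a). comult x \<otimes>\<^sub>M of_alg y)" "cbilinear (\<lambda>(x :: 'a) (y :: 'a). of_alg x \<otimes>\<^sub>M comult y)"
      by (intro cbilinear_compose[OF cbilinear_mtens] clinear_comult clinear_of_alg)+
    note lin_id = clinear_tlift[OF cid(1), folded comult_id_def] clinear_tlift[OF cid(2), folded id_comult_def]
    have m: "((of_alg e \<otimes>\<^sub>M 1) \<otimes>\<^sub>M 1) * comult_id comult t = of_alg (tlift f t)" for t
    proof (rule tensor_eqI[of "\<lambda>t. ((of_alg e \<otimes>\<^sub>M 1) \<otimes>\<^sub>M 1) * comult_id comult t" "\<lambda>t. of_alg (tlift f t)"])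
      fix x y
      have "f x y = to_alg ((of_alg e \<otimes>\<^sub>M 1) * comult x) \<otimes> y" by (rule f_def)
      then have "of_alg (f x y) = ((of_alg e \<otimes>\<^sub>M 1) * comult x) \<otimes>\<^sub>M of_alg y"
        by (simp only: of_alg_tens of_alg_to_alg[OF comult_range(2)])
      then show "((of_alg e \<otimes>\<^sub>M 1) \<otimes>\<^sub>M 1) * comult_id comult (x \<otimes> y) = of_alg (tlift f (x \<otimes> y))"
        by (simp add: comult_id_def tlift_tens cid f mtens_mult)
    qed (intro clinear_compose[OF lin_id(1) clinear_mult_left] clinear_compose[OF clinear_tlift[OF f] clinear_of_alg])+
    have n: "id_comult comult t * (1 \<otimes>\<^sub>M (1 \<otimes>\<^sub>M of_alg c'')) = of_alg (tlift g t)" for t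
    proof (rule tensor_eqI[of "\<lambda>t. id_comult comult t * (1 \<otimes>\<^sub>M (1 \<otimes>\<^sub>M of_alg c''))" "\<lambda>t. of_alg (tlift g t)"])
      fix x y
      have "g x y = x \<otimes> to_alg (comult y * (1 \<otimes>\<^sub>M of_alg c''))" by (rule g_def)
      then have "of_alg (g x y) = of_alg x \<otimes>\<^sub>M (comult y * (1 \<otimes>\<^sub>M of_alg c''))"
        by (simp only: of_alg_tens of_alg_to_alg[OF comult_range(1)])
      then show "id_comult comult (x \<otimes> y) * (1 \<otimes>\<^sub>M (1 \<otimes>\<^sub>M of_alg c'')) = of_alg (tlift g (x \<otimes> y))"
        by (simp add: id_comult_def tlift_tens cid g mtens_mult)
    qed (intro clinear_compose[OF lin_id(2) clinear_mult_right] clinear_compose[OF clinear_tlift[OF g] clinear_of_alg])+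
    have co: "coassociative (comult :: 'a \<Rightarrow> _)" by (rule coassociative_comult)
    have *: "tassoc (tlift f G * t) = tlift g F * tassoc t" for t
      using co[unfolded coassociative_def Let_def, rule_format, of e a c'' t]
      by (simp only: m n G_def[symmetric] F_def[symmetric] mleft_of_alg)
    have tassoc_mult: "tassoc (s * t) = tassoc s * tassoc t" for s t :: "(('a, 'a) tensor, 'a) tensor"
    proof (rule tensor_eqI[of "\<lambda>s. tassoc (s * t)" "\<lambda>s. tassoc s * tassoc t"])
      fix s' :: "('a, 'a) tensor" and z :: 'a
      show "tassoc (s' \<otimes> z * t) = tassoc (s' \<otimes> z) * tassoc t"
      proof (rule tensor_eqI[of "\<lambda>s'. tassoc (s' \<otimes> z * t)" "\<lambda>s'. tassoc (s' \<otimes> z) * tassoc t"])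
        fix x y :: 'a
        show "tassoc (x \<otimes> y \<otimes> z * t) = tassoc (x \<otimes> y \<otimes> z) * tassoc t"
        proof (rule tensor_eqI[of "\<lambda>t. tassoc (x \<otimes> y \<otimes> z * t)" "\<lambda>t. tassoc (x \<otimes> y \<otimes> z) * tassoc t"])
          fix t' :: "('a, 'a) tensor" and z' :: 'a
          show "tassoc (x \<otimes> y \<otimes> z * (t' \<otimes> z')) = tassoc (x \<otimes> y \<otimes> z) * tassoc (t' \<otimes> z')"
            by (induction t') (simp_all add: tens_mult_tens distrib_left distrib_right
                clinear_0[OF clinear_tassoc] clinear_add[OF clinear_tassoc] tassoc_tens tens_simps)
        qed (intro clinear_compose[OF clinear_mult_left clinear_tassoc] clinear_compose[OF clinear_tassoc clinear_mult_left])+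
      qed (intro clinear_compose[OF clinear_compose[OF _ clinear_mult_right] clinear_tassoc]
          clinear_compose[OF clinear_compose[OF _ clinear_tassoc] clinear_mult_right]
          cbilinear_tens[unfolded cbilinear_def, THEN conjunct1, rule_format])+
    qed (intro clinear_compose[OF clinear_mult_right clinear_tassoc] clinear_compose[OF clinear_tassoc clinear_mult_right])+
    have surj: "\<exists>s. tassoc s = t" for t :: "('a, ('a, 'a) tensor) tensor"
    proof (induction t)
      case zero
      show ?case by (rule exI[of _ 0]) (rule clinear_0[OF clinear_tassoc])
    next
      case (add t x u)
      have "\<exists>s. tassoc s = x \<otimes> u"
      proof (induction u)
        case zero
        show ?case by (rule exI[of _ 0]) (simp add: clinear_0[OF clinear_tassoc])
      next
        case (add u y z)
        then show ?case by (metis clinear_add[OF clinear_tassoc] tassoc_tens tens_simps(2))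
      qed
      with add show ?case by (metis clinear_add[OF clinear_tassoc])
    qed
    have "(tassoc (tlift f G) - tlift g F) * t = 0" for t
    proof -
      obtain s where "t = tassoc s" using surj by metis
      then show ?thesis using *[of s] by (simp add: tassoc_mult left_diff_distrib)
    qed
    then have "tassoc (tlift f G) - tlift g F = 0" by (rule nondegenerate_left)
    then have coassoc: "tassoc (tlift f G) = tlift g F" by simp
    define h where "h t = lint2 (mright t (of_alg c' \<otimes>\<^sub>M 1))" for t :: "('a, 'a) tensor"
    have h: "clinear h"
      unfolding h_def by (rule clinear_compose[OF clinear_mright clinear_lint2])
    have h_tens: "h (x \<otimes> y) = lint (x * c') * lint y" for x y
      by (simp add: h_def mright_mtens mright_of_alg mright_one lint2_tens)
    have w: "clinear (\<lambda>u. lint (u * c'))" by (rule clinear_translates[OF clinear_lint])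
    have "slice_right h (tlift g F) = slice_right (\<lambda>u. lint (u * d)) F"
    proof (rule tensor_eqI[of "\<lambda>F. slice_right h (tlift g F)" "slice_right (\<lambda>u. lint (u * d))"])
      fix x y
      define E where "E = to_alg (comult y * (1 \<otimes>\<^sub>M of_alg c''))"
      have E: "of_alg E = comult y * (1 \<otimes>\<^sub>M of_alg c'')"
        unfolding E_def by (rule of_alg_to_alg[OF comult_range(1)])
      have "of_alg (mright E (of_alg c' \<otimes>\<^sub>M 1)) = of_alg (mleft (comult y) (c' \<otimes> c''))"
        by (simp add: of_alg_mleft of_alg_mright E of_alg_tens mtens_mult mult.assoc)
      then have "h E = lint (y * d)"
        unfolding h_def d[symmetric] by (simp add: of_alg_eq_iff)
      then show "slice_right h (tlift g (x \<otimes> y)) = slice_right (\<lambda>u. lint (u * d)) (x \<otimes> y)"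
        by (simp add: tlift_tens[OF g] g_def E_def[symmetric] slice_right_tens[OF h]
            slice_right_tens[OF clinear_translates(1)[OF clinear_lint]])
    qed (intro clinear_compose[OF clinear_tlift[OF g] clinear_slice_right[OF h]]
        clinear_slice_right clinear_translates clinear_lint)+
    also have "\<dots> = e * conv_slice a d"
      by (simp add: mult_conv_slice F_def)
    finally have 1: "slice_right h (tlift g F) = e * conv_slice a d" .
    have sl: "slice_right h (tassoc (t \<otimes> v)) = lint v *\<^sub>C slice_right (\<lambda>u. lint (u * c')) t" for t v
    proof (induction t)
      case (add t x y)
      then show ?case
        by (simp add: tens_simps clinear_add[OF clinear_tassoc] clinear_add[OF clinear_slice_right[OF h]]
            clinear_add[OF clinear_slice_right[OF w]] tassoc_tens slice_right_tens[OF h] slice_right_tens[OF w]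
            h_tens scaleC_add_right scaleC_scaleC mult.commute)
    qed (simp add: clinear_0[OF clinear_tassoc] clinear_0[OF clinear_slice_right[OF h]]
        clinear_0[OF clinear_slice_right[OF w]])
    have "slice_right h (tassoc (tlift f G)) =
        slice_right (\<lambda>u. lint (u * c')) (to_alg ((of_alg e \<otimes>\<^sub>M 1) * comult (slice_right lint G)))"
    proof (rule tensor_eqI[of "\<lambda>G. slice_right h (tassoc (tlift f G))"
          "\<lambda>G. slice_right (\<lambda>u. lint (u * c')) (to_alg ((of_alg e \<otimes>\<^sub>M 1) * comult (slice_right lint G)))"])
      fix x y
      show "slice_right h (tassoc (tlift f (x \<otimes> y))) =
        slice_right (\<lambda>u. lint (u * c')) (to_alg ((of_alg e \<otimes>\<^sub>M 1) * comult (slice_right lint (x \<otimes> y))))"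
        by (simp add: tlift_tens[OF f] f_def sl slice_right_tens[OF clinear_lint]
            clinear_scale[OF lin2] clinear_scale[OF clinear_slice_right[OF w]])
    qed (intro clinear_compose[OF clinear_compose[OF clinear_tlift[OF f] clinear_tassoc] clinear_slice_right[OF h]]
        clinear_compose[OF clinear_compose[OF clinear_slice_right[OF clinear_lint] lin2] clinear_slice_right[OF w]])+
    also have "\<dots> = e * conv_slice (conv_slice a c'') c'"
      by (simp add: mult_conv_slice[of e "conv_slice a c''"]) (simp add: conv_slice_def G_def)
    finally show ?thesis using 1 coassoc by simp
  qed
  then have "e * (conv_slice a d - conv_slice (conv_slice a c'') c') = 0" for e
    by (simp add: right_diff_distrib)
  then have "conv_slice a d - conv_slice (conv_slice a c'') c' = 0" by (rule nondegenerate_right)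
  then show ?thesis by simp
qed


section \<open>The dual\<close>

typedef (overloaded) 'a dual = "{\<omega> :: 'a::algebraic_quantum_group \<Rightarrow> complex. \<exists>c. \<omega> = (\<lambda>a. lint (a * c))}"
  by blast

setup_lifting type_definition_dual

lift_definition pairing :: "'a::algebraic_quantum_group \<Rightarrow> 'a dual \<Rightarrow> complex" ("\<langle>_, _\<rangle>") is "\<lambda>a \<omega>. \<omega> a" .

lemma dual_eqI: "(\<And>a. \<langle>a, b\<rangle> = \<langle>a, b'\<rangle>) \<Longrightarrow> b = b'"
  by transfer blast

text \<open>Some \<open>c\<close> with \<open>b = \<phi>(\<sqdot> c)\<close>.\<close>

definition density :: "'a::algebraic_quantum_group dual \<Rightarrow> 'a" where
  "density b = (SOME c. \<forall>a. \<langle>a, b\<rangle> = lint (a * c))"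

lemma pairing_density: "\<langle>a, b\<rangle> = lint (a * density b)"
proof -
  have "\<exists>c. \<forall>a. \<langle>a, b\<rangle> = lint (a * c)" by transfer (auto simp: fun_eq_iff)
  then show ?thesis unfolding density_def by (rule someI2_ex) blast
qed

instantiation dual :: (algebraic_quantum_group) complex_algebra
begin

lift_definition zero_dual :: "'a dual" is "\<lambda>a. 0"
  by (rule exI[of _ 0]) (simp add: clinear_0[OF clinear_lint])

lift_definition plus_dual :: "'a dual \<Rightarrow> 'a dual \<Rightarrow> 'a dual" is "\<lambda>\<omega> \<omega>' a. \<omega> a + \<omega>' a"
proof clarsimp
  fix c d :: 'a
  have "(\<lambda>a. lint (a * c) + lint (a * d)) = (\<lambda>a. lint (a * (c + d)))"
    by (simp add: clinear_add[OF clinear_lint] distrib_left)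
  then show "\<exists>ca. (\<lambda>a. lint (a * c) + lint (a * d)) = (\<lambda>a. lint (a * ca))" by blast
qed

lift_definition uminus_dual :: "'a dual \<Rightarrow> 'a dual" is "\<lambda>\<omega> a. - \<omega> a"
proof clarsimp
  fix c :: 'a
  have "- lint (a * c) = lint (a * - c)" for a
    using clinear_diff[OF clinear_lint, of 0 "a * c"] by (simp add: clinear_0[OF clinear_lint])
  then show "\<exists>d. (\<lambda>a. - lint (a * c)) = (\<lambda>a. lint (a * d))" by blast
qed

definition minus_dual :: "'a dual \<Rightarrow> 'a dual \<Rightarrow> 'a dual" where
  "minus_dual b b' = b + (- b')"

lift_definition scaleC_dual :: "complex \<Rightarrow> 'a dual \<Rightarrow> 'a dual" is "\<lambda>z \<omega> a. z * \<omega> a"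
proof clarsimp
  fix z and c :: 'a
  have "(\<lambda>a. z * lint (a * c)) = (\<lambda>a. lint (a * (z *\<^sub>C c)))"
    by (simp add: clinear_scale[OF clinear_lint] mult_scaleC_right scaleC_complex_def)
  then show "\<exists>d. (\<lambda>a. z * lint (a * c)) = (\<lambda>a. lint (a * d))" by blast
qed

text \<open>\<open>\<langle>m, b \<otimes> b'\<rangle>\<close> for \<open>m \<in> M(A \<otimes> A)\<close>: if \<open>b = \<phi>(\<sqdot> c)\<close> and \<open>b' = \<phi>(\<sqdot> c')\<close>, then
  \<open>b \<otimes> b' = (\<phi> \<otimes> \<phi>)(\<sqdot> (c \<otimes> c'))\<close> makes sense on multipliers. On \<open>\<Delta>(a)\<close> the value does not depend
  on the choice of \<open>c\<close> and \<open>c'\<close>, see \<open>pairing_mult_comult\<close>.\<close>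

definition pairing_mult :: "('a, 'a) tensor multiplier \<Rightarrow> 'a dual \<Rightarrow> 'a dual \<Rightarrow> complex" where
  "pairing_mult m b b' = lint2 (mleft m (density b \<otimes> density b'))"

lemma pairing_mult_comult:
  assumes "\<And>a. \<langle>a, b\<rangle> = lint (a * c)" "\<And>a. \<langle>a, b'\<rangle> = lint (a * c')"
  shows "pairing_mult (comult a) b b' = lint2 (mleft (comult a) (c \<otimes> c'))"
    and "pairing_mult (comult a) b b' = \<langle>conv_slice a c', b\<rangle>"
proof -
  have "conv_slice a (density b') = conv_slice a c'"
    by (rule conv_slice_cong) (simp add: pairing_density[symmetric] assms)
  then show "pairing_mult (comult a) b b' = \<langle>conv_slice a c', b\<rangle>"
    by (simp add: pairing_mult_def lint2_comult pairing_density)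
  then show "pairing_mult (comult a) b b' = lint2 (mleft (comult a) (c \<otimes> c'))"
    by (simp add: lint2_comult assms)
qed

lift_definition times_dual :: "'a dual \<Rightarrow> 'a dual \<Rightarrow> 'a dual" is "\<lambda>b b' a. pairing_mult (comult a) b b'"
proof -
  fix b b' :: "'a dual"
  obtain d where "\<forall>a. lint2 (mleft (comult a) (density b \<otimes> density b')) = lint (a * d)"
    using lint2_comult_density by blast
  then show "\<exists>c. (\<lambda>a. pairing_mult (comult a) b b') = (\<lambda>a. lint (a * c))"
    by (auto simp: pairing_mult_def)
qed

lemma pairing_simps:
  fixes b b' :: "'a dual"
  shows "\<langle>a, 0 :: 'a dual\<rangle> = 0" "\<langle>a, b + b'\<rangle> = \<langle>a, b\<rangle> + \<langle>a, b'\<rangle>" "\<langle>a, z *\<^sub>C b\<rangle> = z * \<langle>a, b\<rangle>"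
    "\<langle>a, b * b'\<rangle> = pairing_mult (comult a) b b'" "\<langle>a, - b\<rangle> = - \<langle>a, b\<rangle>"
  by (transfer; simp)+

lemma pairing_times: "\<langle>a, b * b'\<rangle> = \<langle>conv_slice a (density b'), b\<rangle>"
  by (simp add: pairing_simps pairing_mult_comult(2)[OF pairing_density pairing_density])

lemma conv_slice_linear:
  fixes a c d :: 'a
  shows "conv_slice a (c + d) = conv_slice a c + conv_slice a d"
  "conv_slice a (z *\<^sub>C c) = z *\<^sub>C conv_slice a c"
proof -
  have bil: "cbilinear (\<lambda>(x :: 'a) y. to_alg (comult x * (1 \<otimes>\<^sub>M of_alg y)))"
    by (rule cbilinear_canonical_map1[OF clinear_comult comult_range(1)])
  show "conv_slice a (c + d) = conv_slice a c + conv_slice a d"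
    "conv_slice a (z *\<^sub>C c) = z *\<^sub>C conv_slice a c"
    unfolding conv_slice_def cbilinear_add_right[OF bil] cbilinear_scale_right[OF bil]
    by (rule clinear_add[OF clinear_slice_right[OF clinear_lint]],
        rule clinear_scale[OF clinear_slice_right[OF clinear_lint]])
qed

lemma clinear_pairing: "clinear (\<lambda>a. \<langle>a, b\<rangle>)" for b :: "'a dual"
  unfolding pairing_density by (rule clinear_translates[OF clinear_lint])

instance
proof
  fix a b c :: "'a dual" and x y :: complex
  show "a + b + c = a + (b + c)" "a + b = b + a" "0 + a = a" "- a + a = 0"
    "x *\<^sub>C (a + b) = x *\<^sub>C a + x *\<^sub>C b" "(x + y) *\<^sub>C a = x *\<^sub>C a + y *\<^sub>C a"
    "x *\<^sub>C y *\<^sub>C a = (x * y) *\<^sub>C a" "1 *\<^sub>C a = a"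
    by (rule dual_eqI; simp add: pairing_simps algebra_simps)+
  show "a - b = a + - b" by (rule minus_dual_def)
  show "(a + b) * c = a * c + b * c" "(x *\<^sub>C a) * b = x *\<^sub>C (a * b)"
    by (rule dual_eqI; simp add: pairing_times pairing_simps(2,3))+
  have right: "\<langle>u, a * b\<rangle> = \<langle>conv_slice u d, a\<rangle>" if "\<And>u. \<langle>u, b\<rangle> = lint (u * d)" for u and a b :: "'a dual" and d
    using pairing_mult_comult(2)[OF pairing_density that] by (simp add: pairing_simps(4))
  show "a * (b + c) = a * b + a * c"
  proof (rule dual_eqI)
    fix u
    have "\<langle>u, b + c\<rangle> = lint (u * (density b + density c))" for u
      by (simp add: pairing_simps(2) pairing_density[of _ b] pairing_density[of _ c] distrib_left clinear_add[OF clinear_lint])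
    from right[OF this] show "\<langle>u, a * (b + c)\<rangle> = \<langle>u, a * b + a * c\<rangle>"
      by (simp add: pairing_simps(2) conv_slice_linear pairing_times clinear_add[OF clinear_pairing])
  qed
  show "a * (x *\<^sub>C b) = x *\<^sub>C (a * b)"
  proof (rule dual_eqI)
    fix u
    have "\<langle>u, x *\<^sub>C b\<rangle> = lint (u * (x *\<^sub>C density b))" for u
      by (simp add: pairing_simps(3) pairing_density[of _ b] mult_scaleC_right clinear_scale[OF clinear_lint] scaleC_complex_def)
    from right[OF this] show "\<langle>u, a * (x *\<^sub>C b)\<rangle> = \<langle>u, x *\<^sub>C (a * b)\<rangle>"
      by (simp add: pairing_simps(3) conv_slice_linear pairing_times clinear_scale[OF clinear_pairing] scaleC_complex_def)
  qed
  show "a * b * c = a * (b * c)"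
  proof (rule dual_eqI)
    fix u
    have bc: "\<langle>v, b * c\<rangle> = lint2 (mleft (comult v) (density b \<otimes> density c))" for v
      by (simp add: pairing_simps(4) pairing_mult_def)
    obtain d where d: "\<forall>v. lint2 (mleft (comult v) (density b \<otimes> density c)) = lint (v * d)"
      using lint2_comult_density by blast
    have "\<langle>u, a * (b * c)\<rangle> = \<langle>conv_slice u d, a\<rangle>"
      by (rule right) (simp add: bc d)
    also have "\<dots> = \<langle>conv_slice (conv_slice u (density c)) (density b), a\<rangle>"
      using conv_slice_conv_slice d by metis
    finally show "\<langle>u, a * b * c\<rangle> = \<langle>u, a * (b * c)\<rangle>"
      by (simp add: pairing_times[of u "a * b" c] pairing_times[of _ a b])
  qed
qed

end

lift_definition act_dual :: "'a::algebraic_quantum_group \<Rightarrow> 'a dual \<Rightarrow> 'a dual" (infixr "\<triangleright>\<^sub>B" 74)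
  is "\<lambda>a \<omega> a'. \<omega> (a' * a)"
  by (auto simp: mult.assoc)

definition act_alg :: "'a::algebraic_quantum_group dual \<Rightarrow> 'a \<Rightarrow> 'a" (infixr "\<triangleright>\<^sub>A" 74) where
  "b \<triangleright>\<^sub>A a = (THE y. \<forall>b'. \<langle>y, b'\<rangle> = \<langle>a, b' * b\<rangle>)"

definition tensor_pairing ::
  "('a::algebraic_quantum_group dual, 'a) tensor \<Rightarrow> ('a, 'a dual) tensor \<Rightarrow> complex" where
  "tensor_pairing s t = tlift (\<lambda>b a. tlift (\<lambda>a' b'. \<langle>a', b\<rangle> * \<langle>a, b'\<rangle>) t) s"

text \<open>Here \<open>F\<close> is the functional \<open>\<langle>m, \<sqdot>\<rangle>\<close> on \<open>A \<otimes> B\<close>, for \<open>m \<in> M(B \<otimes> A)\<close>. It is determined by these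
  values, since both actions are unital.\<close>

definition is_multiplier_pairing ::
  "('a::algebraic_quantum_group dual, 'a) tensor multiplier \<Rightarrow> (('a, 'a dual) tensor \<Rightarrow> complex) \<Rightarrow> bool" where
  "is_multiplier_pairing m F \<longleftrightarrow> clinear F \<and>
    (\<forall>a b a' b'. F ((b \<triangleright>\<^sub>A a') \<otimes> (a \<triangleright>\<^sub>B b')) = tensor_pairing (mleft m (b \<otimes> a)) (a' \<otimes> b'))"

definition act_tensor ::
  "('a::algebraic_quantum_group dual, 'a) tensor \<Rightarrow> ('a, 'a) tensor \<Rightarrow> ('a, 'a) tensor" where
  "act_tensor s t = tlift (\<lambda>b a. tlift (\<lambda>x x'. (b \<triangleright>\<^sub>A x) \<otimes> (a * x')) t) s"

text \<open>The extension of a unital action to multipliers: \<open>m\<close> acts as the linear map with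
  \<open>m \<triangleright> (c \<triangleright> \<xi>) = (mc) \<triangleright> \<xi>\<close>.\<close>

definition multiplier_action ::
  "('c::complex_algebra \<Rightarrow> 'x::complex_vector \<Rightarrow> 'x) \<Rightarrow> 'c multiplier \<Rightarrow> 'x \<Rightarrow> 'x" where
  "multiplier_action act m = (THE f. clinear f \<and> (\<forall>c \<xi>. f (act c \<xi>) = act (mleft m c) \<xi>))"

end

theory Submission
  imports Defs
begin

text \<open>
  If \<open>V(b \<otimes> a) = \<Sum>b\<^sub>i \<otimes> a\<^sub>i\<close>, the values of the pairing of \<open>V\<close> say that \<open>\<Sum>\<langle>y, b\<^sub>i\<rangle> a\<^sub>i = (b \<triangleright> y) a\<close> for all
  \<open>y\<close>. Read in the second leg of \<open>\<Delta>(x)\<close>, this gives \<open>\<Sum>(b\<^sub>i \<triangleright> x) \<otimes> a\<^sub>i x' = x\<^sub>1 \<otimes> (b \<triangleright> x\<^sub>2) a x'\<close>, and coassociativity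
  turns the right side into \<open>\<Delta>(b \<triangleright> x)(1 \<otimes> a x')\<close>. So \<open>T\<close> maps \<open>(b \<otimes> a) \<triangleright> (x \<otimes> x')\<close> to
  \<open>V(b \<otimes> a) \<triangleright> (x \<otimes> x')\<close>, which determines \<open>T\<close> because the action is unital. To avoid infinite
  sums the comparison is made after slicing the first leg with an element \<open>b''\<close> of the dual: then
  \<open>x\<^sub>1 \<otimes> x\<^sub>2\<close> becomes the honest element \<open>x \<triangleleft> b''\<close>, and coassociativity becomes the fact that the left and
  right actions of \<open>B\<close> on \<open>A\<close> commute (\<open>act_right_act_alg\<close>), that is, associativity of \<open>B\<close>.

  All of this uses that \<open>B\<close> separates the points of \<open>A\<close> (\<open>alg_eqI\<close>), which is the faithfulness of
  \<open>\<phi>\<close>: if \<open>\<phi>(a c) = 0\<close> for all \<open>c\<close> then \<open>a = 0\<close> (\<open>lint_faithful\<close>). Most of the work goes into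
  this fact. The bijectivity of the canonical maps takes the place of the antipode in its proof, whose
  other ingredients are that \<open>\<phi>\<close> and a right integral \<open>\<psi>\<close> have the same null elements
  (\<open>lint_null_iff_right_integral_null\<close>) and that slicing by \<open>\<phi>(\<sqdot> c)\<close> commutes with
  \<open>a \<otimes> x \<mapsto> \<Delta>(a)(x \<otimes> 1)\<close> (\<open>comult_fst_conv_slice\<close>).

  Unitality of the action amounts to two spanning statements, \<open>mult_span\<close> for products in \<open>A\<close> and
  \<open>act_alg_span\<close> for the action of \<open>B\<close>; both come from the surjectivity of canonical maps.
\<close>

section \<open>Tensors, slices and multipliers\<close>

lemma clinear_zero: "clinear (\<lambda>x. 0)"
  by (rule clinearI) simp_all

lemma clinear_tens: "clinear (\<lambda>x. x \<otimes> y)" "clinear (\<lambda>y. x \<otimes> y)"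
  using cbilinear_tens unfolding cbilinear_def by blast+

lemma clinear_mleft_multiplier: "clinear (\<lambda>m. mleft m t)"
  by (rule clinearI) (simp_all add: mleft_simps)

lemma slice_left_mright:
  fixes t :: "('a::complex_algebra, 'b::complex_algebra) tensor"
  assumes "clinear w"
  shows "slice_left w (mright t (1 \<otimes>\<^sub>M of_alg d)) = slice_left w t * d"
    and "slice_left w (mright t (of_alg c \<otimes>\<^sub>M 1)) = slice_left (\<lambda>u. w (u * c)) t"
proof -
  note S = clinear_0[OF clinear_mright] clinear_add[OF clinear_mright]
    clinear_0[OF clinear_slice_left[OF assms]] clinear_add[OF clinear_slice_left[OF assms]]
    slice_left_tens[OF assms]
    clinear_0[OF clinear_slice_left[OF clinear_translates(1)[OF assms]]]
    clinear_add[OF clinear_slice_left[OF clinear_translates(1)[OF assms]]]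
    slice_left_tens[OF clinear_translates(1)[OF assms]]
    mright_mtens mright_of_alg mright_one distrib_right mult_scaleC_left
  show "slice_left w (mright t (1 \<otimes>\<^sub>M of_alg d)) = slice_left w t * d"
    by (induction t) (simp_all add: S)
  show "slice_left w (mright t (of_alg c \<otimes>\<^sub>M 1)) = slice_left (\<lambda>u. w (u * c)) t"
    by (induction t) (simp_all add: S)
qed

lemma slice_right_mleft_mtens_one:
  assumes "clinear w"
  shows "slice_right w (mleft (m \<otimes>\<^sub>M 1) s) = mleft m (slice_right w s)"
  by (rule tensor_eqI[OF clinear_compose[OF clinear_mleft clinear_slice_right[OF assms]]
        clinear_compose[OF clinear_slice_right[OF assms] clinear_mleft]])
    (simp add: mleft_mtens mleft_one slice_right_tens[OF assms] clinear_scale[OF clinear_mleft])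

lemma slice_right_tassoc:
  fixes s :: "(('a::complex_vector, 'b::complex_vector) tensor, 'c::complex_vector) tensor"
  assumes w: "clinear w"
  shows "tmap (\<lambda>x. x) (slice_right w) (tassoc s) = slice_right w s"
proof -
  note lin = clinear_tmap[OF clinear_id clinear_slice_right[OF w]]
  show ?thesis
  proof (rule tensor_eqI[OF clinear_compose[OF clinear_tassoc lin] clinear_slice_right[OF w]])
    fix t :: "('a, 'b) tensor" and z :: 'c
    show "tmap (\<lambda>x. x) (slice_right w) (tassoc (t \<otimes> z)) = slice_right w (t \<otimes> z)"
      by (induction t)
        (simp_all add: clinear_0[OF clinear_tassoc] clinear_0[OF lin] tens_simps slice_right_tens[OF w]
          clinear_0[OF clinear_slice_right[OF w]] clinear_add[OF clinear_slice_right[OF w]]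
          clinear_add[OF clinear_tassoc] clinear_add[OF lin] tassoc_tens scaleC_add_right
          tmap_tens[OF clinear_id clinear_slice_right[OF w]])
  qed
qed

text \<open>Non-degeneracy lets one cancel a factor on each leg, even if the two factors stand on different
  sides.\<close>

lemma legs_cancel:
  fixes p q :: "('a::nondegenerate_algebra, 'b::nondegenerate_algebra) tensor"
  assumes "\<And>e y. (of_alg e \<otimes>\<^sub>M 1) * of_alg p * (1 \<otimes>\<^sub>M of_alg y) = (of_alg e \<otimes>\<^sub>M 1) * of_alg q * (1 \<otimes>\<^sub>M of_alg y)"
  shows "p = q"
proof -
  have "(e \<otimes> f) * p * (x \<otimes> y) = (e \<otimes> f) * q * (x \<otimes> y)" for e f x y
  proof (rule of_alg_eq_iff[THEN iffD1])
    have ef: "of_alg (e \<otimes> f) = (1 \<otimes>\<^sub>M of_alg f) * (of_alg e \<otimes>\<^sub>M 1)"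
      and xy: "of_alg (x \<otimes> y) = (1 \<otimes>\<^sub>M of_alg y) * (of_alg x \<otimes>\<^sub>M 1)"
      by (simp_all add: of_alg_tens mtens_mult)
    have "(1 \<otimes>\<^sub>M of_alg f) * ((of_alg e \<otimes>\<^sub>M 1) * of_alg p * (1 \<otimes>\<^sub>M of_alg y)) * (of_alg x \<otimes>\<^sub>M 1)
      = (1 \<otimes>\<^sub>M of_alg f) * ((of_alg e \<otimes>\<^sub>M 1) * of_alg q * (1 \<otimes>\<^sub>M of_alg y)) * (of_alg x \<otimes>\<^sub>M 1)"
      by (simp only: assms)
    then show "of_alg ((e \<otimes> f) * p * (x \<otimes> y)) = of_alg ((e \<otimes> f) * q * (x \<otimes> y))"
      by (simp only: of_alg_mult ef xy mult.assoc)
  qed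
  then have "(e \<otimes> f) * p * t = (e \<otimes> f) * q * t" for e f t
    by - (rule tensor_eqI[OF clinear_mult_left clinear_mult_left])
  then have "((e \<otimes> f) * p - (e \<otimes> f) * q) * t = 0" for e f t
    by (simp add: left_diff_distrib)
  then have "(e \<otimes> f) * p - (e \<otimes> f) * q = 0" for e f
    by (rule nondegenerate_left)
  then have "s * p = s * q" for s
    by - (rule tensor_eqI[OF clinear_mult_right clinear_mult_right], simp)
  then have "s * (p - q) = 0" for s by (simp add: right_diff_distrib)
  then have "p - q = 0" by (rule nondegenerate_right)
  then show ?thesis by simp
qed

text \<open>When the second legs are taken from a basis, the coordinate functionals recover the first legs as
  slices.\<close>

lemma tensor_in_of_slices:
  fixes t :: "('a::complex_vector, 'b::complex_vector) tensor"
  assumes "\<And>w. clinear w \<Longrightarrow> slice_right w t \<in> N"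
  shows "\<exists>F y. finite F \<and> y ` F \<subseteq> N \<and> t = (\<Sum>e\<in>F. y e \<otimes> e)"
proof -
  define B :: "'b set" where "B = cvs.extend_basis {}"
  have indep: "cvs.independent B" and span: "cvs.span B = UNIV"
    unfolding B_def by (simp_all add: cvs.independent_extend_basis cvs.span_extend_basis cvs.independent_empty)
  obtain F y where F: "finite F" "F \<subseteq> B" "tflip t = (\<Sum>e\<in>F. e \<otimes> y e)"
    using tensor_basis_form[OF span] by blast
  have "tflip (\<Sum>e\<in>F. e \<otimes> y e) = (\<Sum>e\<in>F. y e \<otimes> e)"
    using F(1) by (induction F) (simp_all add: clinear_0[OF clinear_tflip] clinear_add[OF clinear_tflip] tflip_tens)
  with F(3) have t: "t = (\<Sum>e\<in>F. y e \<otimes> e)" by (metis tflip_tflip)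
  have "y e \<in> N" if e: "e \<in> F" for e
  proof -
    define w where "w v = cvs.representation B v e" for v
    have w: "clinear w"
      unfolding w_def by (rule clinearI)
        (simp_all add: cvs.representation_add[OF indep] cvs.representation_scale[OF indep] span scaleC_complex_def)
    have we: "w e' = (if e' = e then 1 else 0)" if "e' \<in> F" for e'
      using F that by (auto simp: w_def cvs.representation_basis[OF indep] subset_iff)
    have "slice_right w t = (\<Sum>e'\<in>F. w e' *\<^sub>C y e')"
      unfolding t using F(1)
      by (induction F) (simp_all add: clinear_0 clinear_add clinear_slice_right slice_right_tens w)
    also have "\<dots> = (\<Sum>e'\<in>F. if e' = e then y e' else 0)"
      by (rule sum.cong) (auto simp: we scaleC_one)
    also have "\<dots> = y e" using F(1) e by simp
    finally show ?thesis using assms[OF w] by simp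
  qed
  with F(1) t show ?thesis by (intro exI[of _ F] exI[of _ y]) auto
qed


section \<open>Coproducts multiplied in one leg\<close>

definition comult_fst :: "'a::algebraic_quantum_group \<Rightarrow> 'a \<Rightarrow> ('a, 'a) tensor" where
  "comult_fst a x = to_alg (comult a * (of_alg x \<otimes>\<^sub>M 1))"

definition comult_snd :: "'a::algebraic_quantum_group \<Rightarrow> 'a \<Rightarrow> ('a, 'a) tensor" where
  "comult_snd a y = to_alg (comult a * (1 \<otimes>\<^sub>M of_alg y))"

lemma of_alg_comult_fst: "of_alg (comult_fst a x) = comult a * (of_alg x \<otimes>\<^sub>M 1)"
  and of_alg_comult_snd: "of_alg (comult_snd a y) = comult a * (1 \<otimes>\<^sub>M of_alg y)"
  unfolding comult_fst_def comult_snd_def by (rule of_alg_to_alg, rule comult_range)+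

lemma mleft_comult_fst: "mleft (comult a) (comult_fst p q) = comult_fst (a * p) q"
  and mleft_comult_snd: "mleft (comult a) (comult_snd p q) = comult_snd (a * p) q"
  by (rule of_alg_eq_iff[THEN iffD1],
      simp add: of_alg_mleft of_alg_comult_fst of_alg_comult_snd comult_mult mult.assoc)+

lemma mleft_comult_tens:
  "mleft (comult a) (x \<otimes> y) = mright (comult_fst a x) (1 \<otimes>\<^sub>M of_alg y)"
  "mleft (comult a) (x \<otimes> y) = mright (comult_snd a y) (of_alg x \<otimes>\<^sub>M 1)"
  by (rule of_alg_eq_iff[THEN iffD1],
      simp add: of_alg_mleft of_alg_mright of_alg_comult_fst of_alg_comult_snd of_alg_tens
        mult.assoc mtens_mult)+

lemma cbilinear_comult_fst: "cbilinear comult_fst"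
  and cbilinear_comult_snd: "cbilinear comult_snd"
  by (rule cbilinearI; rule of_alg_eq_iff[THEN iffD1];
      simp add: of_alg_comult_fst of_alg_comult_snd of_alg_add of_alg_scale
        clinear_add[OF clinear_comult] clinear_scale[OF clinear_comult]
        cbilinear_simps[OF cbilinear_mtens] distrib_left distrib_right
        mult_scaleC_left mult_scaleC_right)+

lemma canonical_map1_comult: "canonical_map1 comult = tlift comult_snd"
  unfolding canonical_map1_def comult_snd_def ..

lemma bij_tlift_comult_snd:
  "bij (tlift comult_snd :: ('a::algebraic_quantum_group, 'a) tensor \<Rightarrow> _)"
  using regular_multiplier_Hopf[where 'a = 'a]
  unfolding regular_multiplier_Hopf_def canonical_map1_comult by blast

text \<open>This map differs from the first canonical map of the flipped coproduct only by the flip of the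
  target, and the axioms ask that canonical map to be bijective.\<close>

lemma bij_tlift_comult_fst:
  "bij (tlift comult_fst :: ('a::algebraic_quantum_group, 'a) tensor \<Rightarrow> _)"
proof -
  let ?D = "\<lambda>a :: 'a. mflip (comult a)"
  have flip: "?D a * (1 \<otimes>\<^sub>M of_alg x) = mflip (comult a * (of_alg x \<otimes>\<^sub>M 1))" for a x :: 'a
    by (simp add: mflip_mult mflip_mtens)
  have eq: "to_alg (?D a * (1 \<otimes>\<^sub>M of_alg x)) = tflip (comult_fst a x)" for a x :: 'a
    by (simp add: flip of_alg_comult_fst[symmetric] of_alg_tflip[symmetric])
  have bil: "cbilinear (\<lambda>a x :: 'a. tflip (comult_fst a x))"
    by (rule clinear_cbilinear[OF cbilinear_comult_fst clinear_tflip])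
  have "canonical_map1 ?D t = tflip (tlift comult_fst t)" for t
    unfolding canonical_map1_def eq
    by (rule tensor_eqI[OF clinear_tlift[OF bil]
          clinear_compose[OF clinear_tlift[OF cbilinear_comult_fst] clinear_tflip]])
      (simp add: tlift_tens bil cbilinear_comult_fst)
  then have "tlift comult_fst = tflip \<circ> canonical_map1 ?D"
    by (simp add: fun_eq_iff tflip_tflip)
  moreover have "bij (canonical_map1 ?D)"
    using regular_multiplier_Hopf[where 'a = 'a] unfolding regular_multiplier_Hopf_def by blast
  moreover have "bij (tflip :: ('a, 'a) tensor \<Rightarrow> _)"
    by (rule o_bij[of tflip]) (simp_all add: fun_eq_iff tflip_tflip)
  ultimately show ?thesis by (simp add: bij_comp)
qed

lemma slice_right_mleft_comult: "slice_right lint (mleft (comult a) (x \<otimes> c)) = conv_slice a c * x"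
  by (simp add: mleft_comult_tens(2) slice_right_mult(1)[OF clinear_lint] conv_slice_def comult_snd_def)

lemma clinear_conv_slice: "clinear (\<lambda>u. conv_slice u c)" "clinear (conv_slice a)"
proof -
  have "cbilinear (\<lambda>u c. conv_slice u c)"
    unfolding conv_slice_def comult_snd_def[symmetric]
    by (rule clinear_cbilinear[OF cbilinear_comult_snd clinear_slice_right[OF clinear_lint]])
  then show "clinear (\<lambda>u. conv_slice u c)" "clinear (conv_slice a)" unfolding cbilinear_def by auto
qed


section \<open>Spanning sets\<close>

text \<open>Spanning statements take the form of an extensionality rule for linear maps: two linear maps
  that agree on all values of a bilinear map with surjective lift are equal.\<close>

lemma clinear_eq_of_surj:
  assumes f: "cbilinear f" "surj (tlift f)"
    and g: "clinear g" and h: "clinear h" and eq: "\<And>x y. g (f x y) = h (f x y)"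
  shows "g t = h t"
proof -
  obtain s where s: "t = tlift f s" using f(2) by blast
  show ?thesis unfolding s
    by (rule tensor_eqI[OF clinear_compose[OF clinear_tlift[OF f(1)] g]
          clinear_compose[OF clinear_tlift[OF f(1)] h]])
      (simp add: tlift_tens[OF f(1)] eq)
qed

lemmas comult_fst_span = clinear_eq_of_surj[OF cbilinear_comult_fst bij_is_surj[OF bij_tlift_comult_fst]]
lemmas comult_snd_span = clinear_eq_of_surj[OF cbilinear_comult_snd bij_is_surj[OF bij_tlift_comult_snd]]

text \<open>The algebra is spanned by products. For a functional \<open>w\<close> that vanishes on all products, the
  slice \<open>(\<iota> \<otimes> w)(\<Delta>(p)(c \<otimes> q))\<close> is zero because \<open>\<Delta>(p)(c \<otimes> 1)\<close> already lies in \<open>A \<otimes> A\<close>, so that \<open>q\<close>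
  makes the second leg a product. Cancelling \<open>c\<close>, the slice of \<open>\<Delta>(p)(1 \<otimes> q)\<close> is zero as well; but these
  elements span \<open>A \<otimes> A\<close>, and hence \<open>w = 0\<close>.\<close>

lemma mult_span:
  fixes f g :: "'a::algebraic_quantum_group \<Rightarrow> 'b::complex_vector"
  assumes f: "clinear f" and g: "clinear g" and eq: "\<And>x y. f (x * y) = g (x * y)"
  shows "f a = g a"
proof -
  have vanish: "w a = 0" if w: "clinear w" and w0: "\<And>x y. w (x * y) = 0" for w :: "'a \<Rightarrow> complex" and a
  proof -
    have "slice_right w (comult_snd p q) * c = 0" for p q c
    proof -
      have "slice_right w (mright t (1 \<otimes>\<^sub>M of_alg q)) = 0" for t :: "('a, 'a) tensor"
        unfolding slice_right_mult(3)[OF w] w0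
        by (rule tensor_eqI[OF clinear_slice_right[OF clinear_zero] clinear_zero])
          (simp add: slice_right_tens[OF clinear_zero])
      then show ?thesis
        by (simp add: slice_right_mult(1)[OF w, symmetric] mleft_comult_tens(2)[symmetric])
          (simp add: mleft_comult_tens(1))
    qed
    then have "slice_right w (comult_snd p q) = 0" for p q
      by (rule nondegenerate_left)
    then have z: "slice_right w t = 0" for t :: "('a, 'a) tensor"
      by (rule comult_snd_span[OF clinear_slice_right[OF w] clinear_zero])
    have "w a *\<^sub>C x = 0" for x :: 'a
      using z[of "x \<otimes> a"] by (simp add: slice_right_tens[OF w])
    moreover obtain x :: 'a where "lint x \<noteq> 0" using left_integral unfolding left_integral_def by blast
    ultimately have "w a *\<^sub>C x = 0" and "lint x \<noteq> 0" by auto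
    then show ?thesis
      using clinear_scale[OF clinear_lint, of "w a" x]
      by (auto simp: clinear_0[OF clinear_lint] scaleC_complex_def)
  qed
  have "f a - g a = 0"
  proof (rule functionals_separate)
    fix w :: "'b \<Rightarrow> complex" assume w: "clinear w"
    have "clinear (\<lambda>x. w (f x - g x))"
      by (rule clinearI) (simp_all add: clinear_add[OF f] clinear_add[OF g] clinear_scale[OF f]
          clinear_scale[OF g] clinear_diff[OF w] clinear_add[OF w] clinear_scale[OF w] scaleC_complex_def algebra_simps)
    then show "w (f a - g a) = 0" by (rule vanish) (simp add: eq clinear_0[OF w])
  qed
  then show ?thesis by simp
qed


section \<open>Coassociativity for slices\<close>

text \<open>The third leg of the coassociativity equation is sliced by \<open>\<phi>\<close>. As this is an equation of
  multipliers, it is first evaluated at \<open>(x \<otimes> y) \<otimes> z\<close>, which yields the claim with \<open>c z\<close> for \<open>c\<close>;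
  since products span \<open>A\<close>, this is enough.\<close>

lemma conv_slice_coassoc:
  fixes a c e :: "'a::algebraic_quantum_group"
  shows "mleft (of_alg e \<otimes>\<^sub>M 1) (mleft (comult (conv_slice a c)) (x \<otimes> y))
    = tmap (\<lambda>x. x) (\<lambda>u. conv_slice u c) (to_alg ((of_alg e \<otimes>\<^sub>M 1) * comult a)) * (x \<otimes> y)"
    (is "?l c = ?r c")
proof (rule mult_span[of ?l ?r c])
  show "clinear ?l"
    by (rule clinear_compose[OF clinear_compose[OF clinear_compose[OF clinear_conv_slice(2) clinear_comult]
            clinear_mleft_multiplier] clinear_mleft])
  have "clinear (\<lambda>c. tmap (\<lambda>x. x) (\<lambda>u. conv_slice u c) t)" for t :: "('a, 'a) tensor"
    unfolding tmap_def
  proof (rule clinear_tlift_param)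
    show "cbilinear (\<lambda>x y. x \<otimes> conv_slice y c)" for c :: 'a
      by (rule cbilinear_tmap[OF clinear_id clinear_conv_slice(1)])
    show "clinear (\<lambda>c. x \<otimes> conv_slice y c)" for x y :: 'a
      by (rule clinear_compose[OF clinear_conv_slice(2) clinear_tens(2)])
  qed
  then show "clinear ?r" by (rule clinear_compose[OF _ clinear_mult_right])
next
  fix c z :: 'a
  define F G where "F = to_alg ((of_alg e \<otimes>\<^sub>M 1) * comult a)" and "G = comult_snd a c"
  have G: "to_alg (comult a * (1 \<otimes>\<^sub>M of_alg c)) = G" by (simp add: G_def comult_snd_def)
  have wz: "clinear (\<lambda>v :: 'a. lint (v * z))" by (rule clinear_translates[OF clinear_lint])
  have bil: "cbilinear (\<lambda>(x :: 'a) (y :: 'a). comult x \<otimes>\<^sub>M of_alg y)"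
      "cbilinear (\<lambda>(x :: 'a) (y :: 'a). of_alg x \<otimes>\<^sub>M comult y)"
    by (intro cbilinear_compose[OF cbilinear_mtens] clinear_comult clinear_of_alg)+
  note lin = clinear_tlift[OF bil(1), folded comult_id_def] clinear_tlift[OF bil(2), folded id_comult_def]
  have left: "slice_right lint (mleft (comult_id comult t) ((x \<otimes> y) \<otimes> z))
      = mleft (comult (slice_right (\<lambda>v. lint (v * z)) t)) (x \<otimes> y)" for t
    by (rule tensor_eqI[of "\<lambda>t. slice_right lint (mleft (comult_id comult t) ((x \<otimes> y) \<otimes> z))"],
        rule clinear_compose[OF clinear_compose[OF lin(1) clinear_mleft_multiplier] clinear_slice_right[OF clinear_lint]],
        rule clinear_compose[OF clinear_compose[OF clinear_slice_right[OF wz] clinear_comult] clinear_mleft_multiplier])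
      (simp add: comult_id_def tlift_tens[OF bil(1)] mleft_mtens mleft_of_alg slice_right_tens[OF clinear_lint]
        slice_right_tens[OF wz] clinear_scale[OF clinear_comult] mleft_simps)
  have sl: "clinear (slice_right lint :: ('a, 'a) tensor \<Rightarrow> 'a)" by (rule clinear_slice_right[OF clinear_lint])
  have right: "tmap (\<lambda>x. x) (slice_right lint) (mleft (id_comult comult t) (x \<otimes> (y \<otimes> d)))
      = tmap (\<lambda>x. x) (\<lambda>u. conv_slice u d) t * (x \<otimes> y)" for t d
    by (rule tensor_eqI[of "\<lambda>t. tmap (\<lambda>x. x) (slice_right lint) (mleft (id_comult comult t) (x \<otimes> (y \<otimes> d)))"],
        rule clinear_compose[OF clinear_compose[OF lin(2) clinear_mleft_multiplier] clinear_tmap[OF clinear_id sl]],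
        rule clinear_compose[OF clinear_tmap[OF clinear_id clinear_conv_slice(1)] clinear_mult_right])
      (simp add: id_comult_def tlift_tens[OF bil(2)] mleft_mtens mleft_of_alg tmap_tens[OF clinear_id sl]
        tmap_tens[OF clinear_id clinear_conv_slice(1)] slice_right_mleft_comult tens_mult_tens)
  have "comult_snd a (c * z) = mright (comult_snd a c) (1 \<otimes>\<^sub>M of_alg z)"
    by (rule of_alg_eq_iff[THEN iffD1])
      (simp add: of_alg_comult_snd of_alg_mright mult.assoc mtens_mult of_alg_mult)
  then have cz: "conv_slice a (c * z) = slice_right (\<lambda>v. lint (v * z)) G"
    by (simp add: conv_slice_def comult_snd_def[symmetric] slice_right_mult(3)[OF clinear_lint] G_def)
  let ?t = "(x \<otimes> y) \<otimes> z"
  have "tassoc (mleft (((of_alg e \<otimes>\<^sub>M 1) \<otimes>\<^sub>M 1) * comult_id comult G) ?t)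
      = mleft (id_comult comult F * (1 \<otimes>\<^sub>M (1 \<otimes>\<^sub>M of_alg c))) (tassoc ?t)"
    using coassociative_comult[unfolded coassociative_def Let_def, rule_format, of e a c ?t]
    by (simp only: G F_def)
  from arg_cong[OF this, of "tmap (\<lambda>x. x) (slice_right lint)"]
  show "?l (c * z) = ?r (c * z)"
    by (simp only: slice_right_tassoc[OF clinear_lint] mleft_simps slice_right_mleft_mtens_one[OF clinear_lint]
        left right cz[symmetric] tassoc_tens mleft_mtens mleft_one mleft_of_alg F_def[symmetric])
qed

text \<open>Moving \<open>x\<close> into the slice on the right side of \<open>conv_slice_coassoc\<close> and cancelling \<open>e\<close> and \<open>y\<close>
  removes the auxiliary factors. In Sweedler notation both sides are \<open>a\<^sub>1 x \<otimes> a\<^sub>2 \<phi>(a\<^sub>3 c)\<close>.\<close>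

lemma comult_fst_conv_slice:
  fixes a c x :: "'a::algebraic_quantum_group"
  shows "comult_fst (conv_slice a c) x = tmap (\<lambda>x. x) (\<lambda>u. conv_slice u c) (comult_fst a x)"
proof (rule legs_cancel)
  fix e y :: 'a
  define F where "F = to_alg ((of_alg e \<otimes>\<^sub>M 1) * comult a)"
  have F: "of_alg F = (of_alg e \<otimes>\<^sub>M 1) * comult a"
    unfolding F_def by (rule of_alg_to_alg[OF comult_range(2)])
  let ?K = "tmap (\<lambda>x. x) (\<lambda>u. conv_slice u c)"
  have K: "clinear ?K" by (rule clinear_tmap[OF clinear_id clinear_conv_slice(1)])
  have Kr: "?K (mright t (of_alg x \<otimes>\<^sub>M 1)) = mright (?K t) (of_alg x \<otimes>\<^sub>M 1)" for t
    by (rule tensor_eqI[OF clinear_compose[OF clinear_mright K] clinear_compose[OF K clinear_mright]])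
      (simp add: mright_mtens mright_one mright_of_alg tmap_tens[OF clinear_id clinear_conv_slice(1)])
  have Kl: "?K (mleft (of_alg e \<otimes>\<^sub>M 1) t) = mleft (of_alg e \<otimes>\<^sub>M 1) (?K t)" for t
    by (rule tensor_eqI[OF clinear_compose[OF clinear_mleft K] clinear_compose[OF K clinear_mleft]])
      (simp add: mleft_mtens mleft_one mleft_of_alg tmap_tens[OF clinear_id clinear_conv_slice(1)])
  have Fx: "mright F (of_alg x \<otimes>\<^sub>M 1) = mleft (of_alg e \<otimes>\<^sub>M 1) (comult_fst a x)"
    by (rule of_alg_eq_iff[THEN iffD1])
      (simp add: of_alg_mleft of_alg_mright F of_alg_comult_fst mult.assoc)
  have xy: "of_alg (x \<otimes> y) = (of_alg x \<otimes>\<^sub>M 1) * (1 \<otimes>\<^sub>M of_alg y)"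
    by (simp add: of_alg_tens mtens_mult)
  have "(of_alg e \<otimes>\<^sub>M 1) * of_alg (comult_fst (conv_slice a c) x) * (1 \<otimes>\<^sub>M of_alg y)
      = of_alg (mleft (of_alg e \<otimes>\<^sub>M 1) (mleft (comult (conv_slice a c)) (x \<otimes> y)))"
    by (simp only: of_alg_mleft of_alg_comult_fst xy mult.assoc)
  also have "\<dots> = of_alg (mright (?K F) (of_alg x \<otimes>\<^sub>M 1)) * (1 \<otimes>\<^sub>M of_alg y)"
    by (simp only: conv_slice_coassoc F_def[symmetric] of_alg_mult of_alg_mright xy mult.assoc)
  also have "\<dots> = (of_alg e \<otimes>\<^sub>M 1) * of_alg (?K (comult_fst a x)) * (1 \<otimes>\<^sub>M of_alg y)"
    by (simp only: Kr[symmetric] Fx Kl of_alg_mleft)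
  finally show "(of_alg e \<otimes>\<^sub>M 1) * of_alg (comult_fst (conv_slice a c) x) * (1 \<otimes>\<^sub>M of_alg y)
      = (of_alg e \<otimes>\<^sub>M 1) * of_alg (?K (comult_fst a x)) * (1 \<otimes>\<^sub>M of_alg y)" .
qed


section \<open>The left integral is faithful\<close>

lemma slice_right_comult_fst: "slice_right lint (comult_fst a x) = lint a *\<^sub>C x"
  unfolding comult_fst_def by (rule slice_comult)

lemma slice_left_comult_snd: "right_integral comult w \<Longrightarrow> slice_left w (comult_snd a y) = w a *\<^sub>C y"
  unfolding right_integral_def is_slice_left_def comult_snd_def
  by (metis mleft_one mleft_simps(3))

lemma lint_nonzero: obtains x :: "'a::algebraic_quantum_group" where "lint x \<noteq> 0"
  using left_integral unfolding left_integral_def by blast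

text \<open>Left invariance applied to \<open>a p\<close> gives \<open>(\<iota> \<otimes> \<phi>)(\<Delta>(a)\<Delta>(p)(q \<otimes> 1)) = \<phi>(a p) q\<close>, and the elements
  \<open>\<Delta>(p)(q \<otimes> 1)\<close> span \<open>A \<otimes> A\<close>. Right integrals are treated in the same way with \<open>\<Delta>(p)(1 \<otimes> q)\<close> in
  \<open>slice_left_null\<close>.\<close>

lemma slice_right_null:
  assumes "\<And>c. lint (a * c) = 0"
  shows "slice_right lint (mleft (comult a) t) = 0"
  by (rule comult_fst_span[OF clinear_compose[OF clinear_mleft clinear_slice_right[OF clinear_lint]] clinear_zero])
    (simp add: mleft_comult_fst slice_right_comult_fst assms)

lemma slice_left_null:
  assumes w: "right_integral comult w" and "\<And>c. w (a * c) = 0"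
  shows "slice_left w (mleft (comult a) t) = 0"
proof -
  have lin: "clinear w" using w unfolding right_integral_def by blast
  show ?thesis
    by (rule comult_snd_span[OF clinear_compose[OF clinear_mleft clinear_slice_left[OF lin]] clinear_zero])
      (simp add: mleft_comult_snd slice_left_comult_snd[OF w] assms(2))
qed

lemma lint_null_iff_conv_slice:
  "(\<forall>c. lint (a * c) = 0) \<longleftrightarrow> (\<forall>c. conv_slice a c = 0)"
proof (intro iffI allI)
  fix c assume "\<forall>c. lint (a * c) = 0"
  then have "conv_slice a c * x = 0" for x
    by (simp add: slice_right_mleft_comult[symmetric] slice_right_null)
  then show "conv_slice a c = 0" by (rule nondegenerate_left)
next
  fix c assume null: "\<forall>c. conv_slice a c = 0"
  have "slice_right lint (mleft (comult a) t) = 0" for t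
    by (rule tensor_eqI[OF clinear_compose[OF clinear_mleft clinear_slice_right[OF clinear_lint]] clinear_zero])
      (simp add: slice_right_mleft_comult null)
  from this[of "comult_fst c _"] have "lint (a * c) *\<^sub>C q = 0" for q :: 'a
    by (simp add: mleft_comult_fst slice_right_comult_fst)
  moreover obtain q :: 'a where "lint q \<noteq> 0" by (rule lint_nonzero)
  then have "q \<noteq> 0" by (auto simp: clinear_0[OF clinear_lint])
  ultimately show "lint (a * c) = 0" by (metis cvs.scale_eq_0_iff)
qed

text \<open>For the right integral \<open>\<psi>\<close>, the functional \<open>t \<mapsto> (\<psi> \<otimes> \<phi>)(\<Delta>(a) t)\<close> has the value \<open>\<psi>(a p) \<phi>(q)\<close> at
  \<open>\<Delta>(p)(1 \<otimes> q)\<close> and the value \<open>\<phi>(a p) \<psi>(q)\<close> at \<open>\<Delta>(p)(q \<otimes> 1)\<close>. Both families span \<open>A \<otimes> A\<close>, so either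
  null condition on \<open>a\<close> makes the functional zero, and the other condition can then be read off from
  the values on the other family.\<close>

lemma lint_null_iff_right_integral_null:
  fixes a :: "'a::algebraic_quantum_group"
  assumes w: "right_integral comult w"
  shows "(\<forall>c. lint (a * c) = 0) \<longleftrightarrow> (\<forall>c. w (a * c) = 0)"
proof -
  have lin: "clinear w" using w unfolding right_integral_def by blast
  note swap = slice_left_right[OF clinear_lint lin]
  show ?thesis
  proof (intro iffI allI)
    fix c assume "\<forall>c. lint (a * c) = 0"
    then have "lint (slice_left w (mleft (comult a) t)) = 0" for t
      by (simp add: swap slice_right_null clinear_0[OF lin])
    from this[of "comult_snd c _"] have "lint (w (a * c) *\<^sub>C q) = 0" for q :: 'a
      by (simp add: mleft_comult_snd slice_left_comult_snd[OF w])
    moreover obtain q :: 'a where "lint q \<noteq> 0" by (rule lint_nonzero)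
    ultimately show "w (a * c) = 0"
      by (metis clinear_scale[OF clinear_lint] mult_eq_0_iff scaleC_complex_def)
  next
    fix c assume "\<forall>c. w (a * c) = 0"
    then have "w (slice_right lint (mleft (comult a) t)) = 0" for t
      by (simp add: swap[symmetric] slice_left_null[OF w] clinear_0[OF clinear_lint])
    from this[of "comult_fst c _"] have "w (lint (a * c) *\<^sub>C q) = 0" for q :: 'a
      by (simp add: mleft_comult_fst slice_right_comult_fst)
    moreover obtain q where "w q \<noteq> 0" using w unfolding right_integral_def by blast
    ultimately show "lint (a * c) = 0"
      by (metis clinear_scale[OF lin] mult_eq_0_iff scaleC_complex_def)
  qed
qed

text \<open>Let \<open>N\<close> be the set of all \<open>y\<close> with \<open>\<phi>(y c) = 0\<close> for all \<open>c\<close>, and let \<open>a \<in> N\<close>. Write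
  \<open>b \<otimes> a = \<Sum>\<Delta>(y\<^sub>i)(x\<^sub>i \<otimes> 1)\<close> with independent \<open>x\<^sub>i\<close> and \<open>\<psi>(b) \<noteq> 0\<close> for a right integral \<open>\<psi>\<close>. Expanding the
  second leg by \<open>\<Delta>\<close> and slicing off \<open>\<phi>(\<sqdot> c)\<close> annihilates the left side, because \<open>conv_slice a c = 0\<close>,
  and by coassociativity replaces \<open>y\<^sub>i\<close> by \<open>conv_slice y\<^sub>i c\<close> on the right. The canonical map is injective, so
  \<open>conv_slice y\<^sub>i c = 0\<close>, that is, \<open>y\<^sub>i \<in> N\<close>. But then \<open>\<psi>\<close> also annihilates \<open>y\<^sub>i c\<close> for all \<open>c\<close>, so that
  \<open>(\<psi> \<otimes> \<iota>)(\<Delta>(y\<^sub>i)(x\<^sub>i \<otimes> 1)) = 0\<close>, and the sum of these is \<open>\<psi>(b) a\<close>.\<close>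

lemma lint_faithful:
  fixes a :: "'a::algebraic_quantum_group"
  assumes a: "\<And>c. lint (a * c) = 0"
  shows "a = 0"
proof -
  obtain w :: "'a \<Rightarrow> complex" where w: "right_integral comult w" using right_integral_exists by blast
  then obtain b where lin: "clinear w" and b: "w b \<noteq> 0" unfolding right_integral_def by blast
  define N where "N = {y :: 'a. \<forall>c. lint (y * c) = 0}"
  obtain t where t: "tlift comult_fst t = b \<otimes> a"
    using bij_tlift_comult_fst by (metis bij_is_surj surjD)
  have "slice_right v t \<in> N" if v: "clinear v" for v
  proof -
    have "conv_slice (slice_right v t) c = 0" for c
    proof -
      let ?k = "\<lambda>u. conv_slice u c"
      note k = clinear_conv_slice(1)[of c]
      have "tlift comult_fst (tmap ?k (\<lambda>x. x) s) = tmap (\<lambda>x. x) ?k (tlift comult_fst s)" for s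
        by (rule tensor_eqI[OF
              clinear_compose[OF clinear_tmap[OF k clinear_id] clinear_tlift[OF cbilinear_comult_fst]]
              clinear_compose[OF clinear_tlift[OF cbilinear_comult_fst] clinear_tmap[OF clinear_id k]]])
          (simp add: tmap_tens[OF k clinear_id] tlift_tens[OF cbilinear_comult_fst] comult_fst_conv_slice)
      then have "tlift comult_fst (tmap ?k (\<lambda>x. x) t) = b \<otimes> conv_slice a c"
        by (simp add: t tmap_tens[OF clinear_id k])
      also have "\<dots> = tlift comult_fst 0"
        using a lint_null_iff_conv_slice[of a] by (simp add: tlift_simps[OF cbilinear_comult_fst])
      finally have "tmap ?k (\<lambda>x. x) t = 0"
        using bij_tlift_comult_fst by (metis bij_is_inj injD)
      moreover have "slice_right v (tmap ?k (\<lambda>x. x) s) = ?k (slice_right v s)" for s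
        by (rule tensor_eqI[OF clinear_compose[OF clinear_tmap[OF k clinear_id] clinear_slice_right[OF v]]
              clinear_compose[OF clinear_slice_right[OF v] k]])
          (simp add: tmap_tens[OF k clinear_id] slice_right_tens[OF v] clinear_scale[OF k])
      ultimately show ?thesis by (metis clinear_0[OF clinear_slice_right[OF v]])
    qed
    then show ?thesis unfolding N_def using lint_null_iff_conv_slice by blast
  qed
  then obtain F y where F: "finite F" "y ` F \<subseteq> N" "t = (\<Sum>e\<in>F. y e \<otimes> e)"
    using tensor_in_of_slices by metis
  have null: "slice_left w (comult_fst u x) = 0" if "u \<in> N" for u x
  proof -
    have "\<forall>c. w (u * c) = 0"
      using that lint_null_iff_right_integral_null[OF w] unfolding N_def by blast
    then have "slice_left w (comult_fst u x) * z = 0" for z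
      using slice_left_null[OF w, of u "x \<otimes> z"] by (simp add: mleft_comult_tens(1) slice_left_mright[OF lin])
    then show ?thesis by (rule nondegenerate_left)
  qed
  have "slice_left w (tlift comult_fst t) = (\<Sum>e\<in>F. slice_left w (comult_fst (y e) e))"
    unfolding F(3) using F(1)
    by (induction F) (simp_all add: tlift_simps[OF cbilinear_comult_fst] tlift_tens[OF cbilinear_comult_fst]
        clinear_0[OF clinear_slice_left[OF lin]] clinear_add[OF clinear_slice_left[OF lin]])
  also have "\<dots> = 0" by (rule sum.neutral) (use F(2) null in blast)
  finally have "w b *\<^sub>C a = 0" by (simp add: t slice_left_tens[OF lin])
  with b show "a = 0" by simp
qed


section \<open>The dual and its actions\<close>

lemma dual_exists: "\<exists>b. \<forall>a. \<langle>a, b\<rangle> = lint (a * c)"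
proof -
  have "(\<lambda>a. lint (a * c)) \<in> {\<omega>. \<exists>c. \<omega> = (\<lambda>a. lint (a * c))}" by blast
  from Abs_dual_inverse[OF this] show ?thesis by (metis pairing.rep_eq)
qed

lemma alg_eqI:
  fixes a a' :: "'a::algebraic_quantum_group"
  assumes "\<And>b. \<langle>a, b\<rangle> = \<langle>a', b\<rangle>"
  shows "a = a'"
proof -
  have "lint ((a - a') * c) = 0" for c
  proof -
    obtain b where "\<forall>a. \<langle>a, b\<rangle> = lint (a * c)" using dual_exists by blast
    then have "lint (a * c) = lint (a' * c)" using assms[of b] by simp
    then show ?thesis by (simp add: left_diff_distrib clinear_diff[OF clinear_lint])
  qed
  then have "a - a' = 0" by (rule lint_faithful)
  then show ?thesis by simp
qed

lemma pairing_act_alg: "\<langle>b \<triangleright>\<^sub>A x, b'\<rangle> = \<langle>x, b' * b\<rangle>"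
  and act_alg_conv_slice: "b \<triangleright>\<^sub>A x = conv_slice x (density b)"
proof -
  have "b \<triangleright>\<^sub>A x = conv_slice x (density b)"
    unfolding act_alg_def
  proof (rule the_equality)
    show "\<forall>b'. \<langle>conv_slice x (density b), b'\<rangle> = \<langle>x, b' * b\<rangle>" by (simp add: pairing_times)
  next
    fix y assume "\<forall>b'. \<langle>y, b'\<rangle> = \<langle>x, b' * b\<rangle>"
    then show "y = conv_slice x (density b)" by - (rule alg_eqI, simp add: pairing_times)
  qed
  then show "b \<triangleright>\<^sub>A x = conv_slice x (density b)" "\<langle>b \<triangleright>\<^sub>A x, b'\<rangle> = \<langle>x, b' * b\<rangle>"
    by (simp_all add: pairing_times)
qed

lemma cbilinear_act_alg: "cbilinear (\<triangleright>\<^sub>A)"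
  by (rule cbilinearI; rule alg_eqI)
    (simp_all add: pairing_act_alg pairing_simps(2,3) distrib_left mult_scaleC_right
      clinear_add[OF clinear_pairing] clinear_scale[OF clinear_pairing] scaleC_complex_def)

text \<open>The action of the dual on \<open>A\<close> is unital: the elements \<open>(\<iota> \<otimes> \<phi>)(\<Delta>(x)(1 \<otimes> c))\<close> span \<open>A\<close>, as
  \<open>\<iota> \<otimes> \<phi>\<close> is onto and the elements \<open>\<Delta>(x)(1 \<otimes> c)\<close> span \<open>A \<otimes> A\<close>.\<close>

lemma act_alg_span:
  fixes f g :: "'a::algebraic_quantum_group \<Rightarrow> 'b::complex_vector"
  assumes f: "clinear f" and g: "clinear g" and eq: "\<And>b x. f (b \<triangleright>\<^sub>A x) = g (b \<triangleright>\<^sub>A x)"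
  shows "f y = g y"
proof -
  note sl = clinear_slice_right[OF clinear_lint]
  have conv: "f (conv_slice x c) = g (conv_slice x c)" for x c
  proof -
    obtain b where "\<forall>a. \<langle>a, b\<rangle> = lint (a * c)" using dual_exists by blast
    then have "conv_slice x (density b) = conv_slice x c"
      by (intro conv_slice_cong) (simp add: pairing_density[symmetric])
    then show ?thesis using eq[of b x] by (simp add: act_alg_conv_slice)
  qed
  have "f (slice_right lint t) = g (slice_right lint t)" for t :: "('a, 'a) tensor"
    by (rule comult_snd_span[OF clinear_compose[OF sl f] clinear_compose[OF sl g]])
      (use conv in \<open>simp add: conv_slice_def comult_snd_def\<close>)
  from this[of "y \<otimes> c" for c]
  have *: "lint c *\<^sub>C f y = lint c *\<^sub>C g y" for c :: 'a
    by (simp add: slice_right_tens[OF clinear_lint] clinear_scale[OF f] clinear_scale[OF g])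
  obtain c :: 'a where "lint c \<noteq> 0" by (rule lint_nonzero)
  with *[of c] show ?thesis by simp
qed

text \<open>The right action \<open>x \<triangleleft> b = (b \<otimes> \<iota>)\<Delta>(x)\<close> of the dual, for \<open>b = \<phi>(\<sqdot> c)\<close> in the form
  \<open>(\<phi> \<otimes> \<iota>)(\<Delta>(x)(c \<otimes> 1))\<close>.\<close>

definition act_right :: "'a::algebraic_quantum_group \<Rightarrow> 'a dual \<Rightarrow> 'a" where
  "act_right x b = slice_left lint (comult_fst x (density b))"

lemma pairing_act_right: "\<langle>act_right x b, b'\<rangle> = \<langle>x, b * b'\<rangle>"
proof -
  have "lint (slice_right lint t) = lint (slice_left lint t)" for t :: "('a, 'a) tensor"
    by (simp add: slice_left_right clinear_lint)
  then show ?thesis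
    by (simp add: pairing_simps(4) pairing_mult_def lint2_slice mleft_comult_tens(1)
        slice_left_mright[OF clinear_lint] act_right_def pairing_density[of _ b'])
qed

lemma slice_left_comult_snd_pairing:
  "slice_left (\<lambda>a. \<langle>a, b\<rangle>) (comult_snd x y) = act_right x b * y"
proof -
  have "slice_left (\<lambda>u. lint (u * density b)) (comult_snd x y)
      = slice_left lint (mleft (comult x) (density b \<otimes> y))"
    by (simp add: mleft_comult_tens(2) slice_left_mright[OF clinear_lint])
  also have "\<dots> = act_right x b * y"
    by (simp add: mleft_comult_tens(1) slice_left_mright[OF clinear_lint] act_right_def)
  finally show ?thesis by (simp add: pairing_density)
qed

text \<open>This is associativity of the product of the dual, read through the pairing.\<close>

lemma act_right_act_alg: "act_right (b \<triangleright>\<^sub>A x) b' = b \<triangleright>\<^sub>A act_right x b'"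
  by (rule alg_eqI) (simp add: pairing_act_alg pairing_act_right mult.assoc)

lemma pairing_slices_separate:
  fixes t t' :: "('a::algebraic_quantum_group, 'b::complex_vector) tensor"
  assumes "\<And>b. slice_left (\<lambda>a. \<langle>a, b\<rangle>) t = slice_left (\<lambda>a. \<langle>a, b\<rangle>) t'"
  shows "t = t'"
proof -
  have z: "slice_left (\<lambda>a. \<langle>a, b\<rangle>) (t - t') = 0" for b
    by (simp add: clinear_diff[OF clinear_slice_left[OF clinear_pairing]] assms)
  have "t - t' = 0"
  proof (rule slices_separate, rule functionals_separate)
    fix w :: "'a \<Rightarrow> complex" and v :: "'b \<Rightarrow> complex"
    assume w: "clinear w" and v: "clinear v"
    have "slice_right v (t - t') = 0"
      by (rule alg_eqI)
        (simp add: slice_left_right[OF v clinear_pairing, symmetric] z clinear_0[OF v] clinear_0[OF clinear_pairing])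
    then show "v (slice_left w (t - t')) = 0"
      by (simp add: slice_left_right[OF v w] clinear_0[OF w])
  qed
  then show ?thesis by simp
qed


section \<open>The multiplier as the canonical map\<close>

lemma
  fixes b :: "'a::algebraic_quantum_group dual"
  shows cbilinear_act_tensor: "cbilinear (act_tensor :: ('a dual, 'a) tensor \<Rightarrow> _)"
    and act_tensor_tens: "act_tensor (b \<otimes> a) (x \<otimes> x') = (b \<triangleright>\<^sub>A x) \<otimes> (a * x')"
proof -
  have lin: "clinear (\<lambda>x. b \<triangleright>\<^sub>A x)" "clinear (\<lambda>b. b \<triangleright>\<^sub>A x)" for b :: "'a dual" and x :: 'a
    using cbilinear_act_alg unfolding cbilinear_def by blast+
  have inner: "cbilinear (\<lambda>x x'. (b \<triangleright>\<^sub>A x) \<otimes> (a * x'))" for b :: "'a dual" and a :: 'a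
    by (rule cbilinear_tmap[OF lin(1) clinear_mult_left])
  have outer: "cbilinear (\<lambda>b a. tlift (\<lambda>x x'. (b \<triangleright>\<^sub>A x) \<otimes> (a * x')) t)" for t :: "('a, 'a) tensor"
    unfolding cbilinear_def
    by (intro allI conjI; rule clinear_tlift_param[OF inner])
      (rule clinear_compose[OF lin(2) clinear_tens(1)] clinear_compose[OF clinear_mult_right clinear_tens(2)])+
  have lin_tens: "clinear (act_tensor s)" for s :: "('a dual, 'a) tensor"
    unfolding act_tensor_def by (rule clinear_tlift_param[OF outer clinear_tlift[OF inner]])
  then show "cbilinear (act_tensor :: ('a dual, 'a) tensor \<Rightarrow> _)"
    unfolding cbilinear_def
    by (simp add: act_tensor_def[abs_def] clinear_tlift[OF outer])
  show "act_tensor (b \<otimes> a) (x \<otimes> x') = (b \<triangleright>\<^sub>A x) \<otimes> (a * x')"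
    unfolding act_tensor_def by (rule trans[OF tlift_tens[OF outer] tlift_tens[OF inner]])
qed

lemma clinear_pairing_right: "clinear (\<lambda>b. \<langle>a, b\<rangle>)"
  by (rule clinearI) (simp_all add: pairing_simps scaleC_complex_def)

lemma tensor_pairing_slice:
  fixes s :: "('a::algebraic_quantum_group dual, 'a) tensor"
  shows "tensor_pairing s (a' \<otimes> b') = \<langle>slice_left (\<lambda>b. \<langle>a', b\<rangle>) s, b'\<rangle>"
proof -
  have inner: "cbilinear (\<lambda>a' b'. \<langle>a', b\<rangle> * \<langle>a, b'\<rangle>)" for a :: 'a and b :: "'a dual"
    by (rule cbilinearI) (simp_all add: clinear_add[OF clinear_pairing] clinear_scale[OF clinear_pairing]
        pairing_simps scaleC_complex_def algebra_simps)
  have outer: "cbilinear (\<lambda>b a. \<langle>a', b\<rangle> * \<langle>a, b'\<rangle>)"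
    by (rule cbilinearI) (simp_all add: clinear_add[OF clinear_pairing] clinear_scale[OF clinear_pairing]
        pairing_simps scaleC_complex_def algebra_simps)
  show ?thesis
    unfolding tensor_pairing_def tlift_tens[OF inner]
    by (rule tensor_eqI[OF clinear_tlift[OF outer]
          clinear_compose[OF clinear_slice_left[OF clinear_pairing_right] clinear_pairing]])
      (simp add: tlift_tens[OF outer] slice_left_tens[OF clinear_pairing_right]
        clinear_scale[OF clinear_pairing] scaleC_complex_def)
qed

text \<open>Slicing the first leg moves the action of \<open>B \<otimes> A\<close> to the pairing, since
  \<open>\<langle>b' \<triangleright> x, b\<rangle> = \<langle>x, b b'\<rangle> = \<langle>x \<triangleleft> b, b'\<rangle>\<close>.\<close>

lemma slice_left_act_tensor:
  "slice_left (\<lambda>a. \<langle>a, b\<rangle>) (act_tensor s (x \<otimes> x')) = slice_left (\<lambda>b'. \<langle>act_right x b, b'\<rangle>) s * x'"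
proof -
  have lin: "clinear (\<lambda>s. act_tensor s (x \<otimes> x'))"
    using cbilinear_act_tensor unfolding cbilinear_def by blast
  show ?thesis
    by (rule tensor_eqI[OF clinear_compose[OF lin clinear_slice_left[OF clinear_pairing]]
          clinear_compose[OF clinear_slice_left[OF clinear_pairing_right] clinear_mult_right]])
      (simp add: act_tensor_tens slice_left_tens[OF clinear_pairing] slice_left_tens[OF clinear_pairing_right]
        pairing_act_alg pairing_act_right[symmetric] mult_scaleC_left)
qed

theorem proposition3p19:
  fixes V :: "('a::algebraic_quantum_group dual, 'a) tensor multiplier"
    and pairing_V :: "('a, 'a dual) tensor \<Rightarrow> complex"
  assumes "is_multiplier_pairing V pairing_V"
    and "\<And>a b. pairing_V (a \<otimes> b) = \<langle>a, b\<rangle>"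
  shows "multiplier_action act_tensor V = canonical_map1 comult"
proof -
  let ?T = "tlift comult_snd :: ('a, 'a) tensor \<Rightarrow> ('a, 'a) tensor"
  note T = clinear_tlift[OF cbilinear_comult_snd] tlift_tens[OF cbilinear_comult_snd]
  \<comment> \<open>For \<open>V(b \<otimes> a) = \<Sum>b\<^sub>i \<otimes> a\<^sub>i\<close> this says \<open>\<Sum>\<langle>y, b\<^sub>i\<rangle> a\<^sub>i = (b \<triangleright> y) a\<close>: pairing with \<open>b'\<close> turns the left
    side into \<open>\<langle>V, (b \<triangleright> y) \<otimes> (a \<triangleright> b')\<rangle>\<close>, and this is \<open>\<langle>b \<triangleright> y, a \<triangleright> b'\<rangle>\<close>.\<close>
  have slice_V: "slice_left (\<lambda>b'. \<langle>y, b'\<rangle>) (mleft V (b \<otimes> a)) = (b \<triangleright>\<^sub>A y) * a" for y a b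
  proof (rule alg_eqI)
    fix b'
    have "\<langle>slice_left (\<lambda>b'. \<langle>y, b'\<rangle>) (mleft V (b \<otimes> a)), b'\<rangle> = pairing_V ((b \<triangleright>\<^sub>A y) \<otimes> (a \<triangleright>\<^sub>B b'))"
      using assms(1) by (simp add: is_multiplier_pairing_def tensor_pairing_slice)
    also have "\<dots> = \<langle>(b \<triangleright>\<^sub>A y) * a, b'\<rangle>"
      unfolding assms(2) by transfer simp
    finally show "\<langle>slice_left (\<lambda>b'. \<langle>y, b'\<rangle>) (mleft V (b \<otimes> a)), b'\<rangle> = \<langle>(b \<triangleright>\<^sub>A y) * a, b'\<rangle>" .
  qed
  \<comment> \<open>Both sides have the same slice by each \<open>b''\<close> in the first leg, namely
    \<open>((b \<triangleright> x) \<triangleleft> b'') a x' = (b \<triangleright> (x \<triangleleft> b'')) a x'\<close>.\<close>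
  have elementary: "?T ((b \<triangleright>\<^sub>A x) \<otimes> (a * x')) = act_tensor (mleft V (b \<otimes> a)) (x \<otimes> x')" for a b x x'
    by (rule pairing_slices_separate)
      (simp add: T slice_left_comult_snd_pairing slice_left_act_tensor slice_V act_right_act_alg mult.assoc)
  have lin: "clinear (act_tensor s)" "clinear (\<lambda>s. act_tensor s t)"
    for s :: "('a dual, 'a) tensor" and t
    using cbilinear_act_tensor unfolding cbilinear_def by blast+
  have T_act: "?T (act_tensor c \<xi>) = act_tensor (mleft V c) \<xi>" for c \<xi>
  proof (rule tensor_eqI[of "\<lambda>c. ?T (act_tensor c \<xi>)" "\<lambda>c. act_tensor (mleft V c) \<xi>"])
    fix b a
    show "?T (act_tensor (b \<otimes> a) \<xi>) = act_tensor (mleft V (b \<otimes> a)) \<xi>"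
      by (rule tensor_eqI[OF clinear_compose[OF lin(1) T(1)] lin(1)]) (simp add: act_tensor_tens elementary)
  qed (rule clinear_compose[OF lin(2) T(1)] clinear_compose[OF clinear_mleft lin(2)])+
  have unique: "f = ?T" if f: "clinear f" "\<And>c \<xi>. f (act_tensor c \<xi>) = act_tensor (mleft V c) \<xi>" for f
  proof
    fix t
    have "f ((b \<triangleright>\<^sub>A x) \<otimes> (a * x')) = ?T ((b \<triangleright>\<^sub>A x) \<otimes> (a * x'))" for b a x x'
      unfolding act_tensor_tens[symmetric] f(2) T_act ..
    then have "f ((b \<triangleright>\<^sub>A x) \<otimes> z) = ?T ((b \<triangleright>\<^sub>A x) \<otimes> z)" for b x z
      by - (rule mult_span[OF clinear_compose[OF clinear_tens(2) f(1)] clinear_compose[OF clinear_tens(2) T(1)]])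
    then have "f (y \<otimes> z) = ?T (y \<otimes> z)" for y z
      by - (rule act_alg_span[OF clinear_compose[OF clinear_tens(1) f(1)] clinear_compose[OF clinear_tens(1) T(1)]])
    then show "f t = ?T t" by - (rule tensor_eqI[OF f(1) T(1)])
  qed
  show ?thesis
    unfolding multiplier_action_def canonical_map1_comult
    by (rule the_equality) (use T(1) T_act unique in blast)+
qed

end
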